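(* In the emission abatement game, let $(\lambda,\mu)\in\mathcal G_l$ with associated random variable $Z$, and write $z_1=\mathbb E[Z]$, $\sigma_z^2=\mathrm{Var}(Z)$. Then $(\lambda,\mu)$ is a mean field CCE if and only if $$z_1^2\,c_M+\sigma_z^2\,c_V\ge0,$$ where $$c_M=\int_0^T\big((\phi_tr_t+g_t)^2+\varepsilon r_t^2\big)dt-T,\qquad c_V=\int_0^T\big(\phi_t^2(v_t-t)^2+\varepsilon v_t^2\big)dt-T,$$ and $$g_t=\int_t^T\phi_se^{-\int_t^s\phi_udu}ds,\qquad r_t=\int_0^t(1-g_s)e^{-\int_s^t\phi_udu}ds,\qquad v_t=\int_0^t(s\phi_s+1)e^{-\int_s^t\phi_udu}ds .$$
   Context: Emission abatement game. Fix $T>0$, constants $a,b\ge0$ and $\varepsilon>0$. $(\Omega,\mathcal F,\mathbb F=(\mathcal F_t)_{t\in[0,T]},\mathbb P)$ is a complete filtered probability space satisfying the usual conditions, $W$ a one-dimensional $\mathbb F$-Brownian motion, $\xi$ a real $\mathcal F_0$-measurable square-integrable random variable independent of $W$, $\nu_1=\mathbb E[\xi]$; $\mathcal F_0$ supports a uniform random variable independent of $(\xi,W)$. $\mathbb F^1$ is the filtration generated by $\xi$ and $W$ (satisfying the usual conditions). $\mathbb H^2(\mathbb G)$ is the set of real $\mathbb G$-progressively measurable processes $\alpha$ with $\mathbb E\int_0^T\alpha_t^2dt<\infty$. "Independent of $\xi$ and $W$" means independent of the pair $(\xi,W)$. For $\alpha\in\mathbb H^2(\mathbb F)$, $X=X^\alpha$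 solves $dX_t=\alpha_tdt+dW_t$, $X_0=\xi$, and $$\mathfrak J(\alpha,\mu)=\mathbb E\Big[\int_0^T\big(a\mu_t-\tfrac b2\mu_t^2-\tfrac12\alpha_t^2-\tfrac\varepsilon2(\mu_t-X_t)^2\big)dt\Big].$$ A correlated flow is a pair $(\lambda,\mu)$ with $\lambda\in\mathbb H^2(\mathbb F)$ and $\mu$ an $\mathcal F_0$-measurable $\mathcal C([0,T];\mathbb R)$-valued random variable independent of $\xi$ and $W$. It is a mean field coarse correlated equilibrium (CCE) if (i) $\mathfrak J(\lambda,\mu)\ge\mathfrak J(\beta,\mu)$ for every $\beta\in\mathbb H^2(\mathbb F^1)$, and (ii) $\mu_t=\mathbb E[X^\lambda_t\mid\mu]$ a.s. for all $t\in[0,T]$. $\phi:[0,T]\to\mathbb R$ solves $\dot\phi_t+\varepsilon-\phi_t^2=0$, $\phi_T=0$. Class $\mathcal G_l$: all correlated flows $(\lambda,\mu)$ with $\mu_t=\nu_1+tZ$ and $\lambda_t=\phi_t(\mu_t-X_t)+Z$, $t\in[0,T]$, where $X=X^\lambda$ and $Z$ is a square-integrable $\mathcal F_0$-measurable real random variable independent of $\xi$ and $W$. *)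

theory Defs
  imports "HOL-Probability.Probability"
begin

text \<open>
  Processes are functions \<open>real \<Rightarrow> 'a \<Rightarrow> real\<close> and filtrations functions \<open>real \<Rightarrow> 'a measure\<close>;
  only the times in \<open>{0..T}\<close> matter.  A filtration enters through the spaces and the
  \<open>\<sigma>\<close>-algebras of its members; their measures are never used.
\<close>

definition filtration_on :: "'a measure \<Rightarrow> real \<Rightarrow> (real \<Rightarrow> 'a measure) \<Rightarrow> bool" where
  "filtration_on M T F \<longleftrightarrow>
     (\<forall>t\<in>{0..T}. subalgebra M (F t)) \<and>
     (\<forall>s\<in>{0..T}. \<forall>t\<in>{s..T}. sets (F s) \<subseteq> sets (F t))"

definition usual_conditions :: "'a measure \<Rightarrow> real \<Rightarrow> (real \<Rightarrow> 'a measure) \<Rightarrow> bool" where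
  "usual_conditions M T F \<longleftrightarrow>
     null_sets M \<subseteq> sets (F 0) \<and>
     (\<forall>t\<in>{0..<T}. sets (F t) = (\<Inter>s\<in>{t<..T}. sets (F s)))"

definition progressively_measurable ::
    "real \<Rightarrow> (real \<Rightarrow> 'a measure) \<Rightarrow> (real \<Rightarrow> 'a \<Rightarrow> real) \<Rightarrow> bool" where
  "progressively_measurable T G \<alpha> \<longleftrightarrow>
     (\<forall>t\<in>{0..T}. (\<lambda>(s, \<omega>). \<alpha> s \<omega>) \<in> borel_measurable (restrict_space borel {0..t} \<Otimes>\<^sub>M G t))"

definition H2 :: "'a measure \<Rightarrow> real \<Rightarrow> (real \<Rightarrow> 'a measure) \<Rightarrow> (real \<Rightarrow> 'a \<Rightarrow> real) set" where
  "H2 M T G = {\<alpha>. progressively_measurable T G \<alpha> \<and>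
     (\<integral>\<^sup>+\<omega>. (\<integral>\<^sup>+t\<in>{0..T}. ennreal ((\<alpha> t \<omega>)\<^sup>2) \<partial>lborel) \<partial>M) < \<infinity>}"

definition brownian_motion ::
    "'a measure \<Rightarrow> real \<Rightarrow> (real \<Rightarrow> 'a measure) \<Rightarrow> (real \<Rightarrow> 'a \<Rightarrow> real) \<Rightarrow> bool" where
  "brownian_motion M T F W \<longleftrightarrow>
     (\<forall>t\<in>{0..T}. W t \<in> borel_measurable (F t)) \<and>
     (AE \<omega> in M. W 0 \<omega> = 0) \<and>
     (AE \<omega> in M. continuous_on {0..T} (\<lambda>t. W t \<omega>)) \<and>
     (\<forall>s\<in>{0..T}. \<forall>t\<in>{s<..T}.
        prob_space.indep_set M (sets (F s))
          (sets (vimage_algebra (space M) (\<lambda>\<omega>. W t \<omega> - W s \<omega>) borel)) \<and>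
        distributed M lborel (\<lambda>\<omega>. W t \<omega> - W s \<omega>) (normal_density 0 (sqrt (t - s))))"

text \<open>Independence of two random variables of different types, for which the library's
  \<open>indep_var\<close> is not polymorphic enough.\<close>

definition indep_rvs ::
    "'a measure \<Rightarrow> 'b measure \<Rightarrow> ('a \<Rightarrow> 'b) \<Rightarrow> 'c measure \<Rightarrow> ('a \<Rightarrow> 'c) \<Rightarrow> bool" where
  "indep_rvs M N X N' Y \<longleftrightarrow>
     X \<in> measurable M N \<and> Y \<in> measurable M N' \<and>
     prob_space.indep_set M (sets (vimage_algebra (space M) X N))
                            (sets (vimage_algebra (space M) Y N'))"

text \<open>The pair \<open>(\<xi>, W)\<close> as a single random variable, used to express independence of the pair.\<close>

definition noise_space :: "real \<Rightarrow> (real \<times> (real \<Rightarrow> real)) measure" where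
  "noise_space T = borel \<Otimes>\<^sub>M PiM {0..T} (\<lambda>_. borel)"

definition noise ::
    "real \<Rightarrow> ('a \<Rightarrow> real) \<Rightarrow> (real \<Rightarrow> 'a \<Rightarrow> real) \<Rightarrow> 'a \<Rightarrow> real \<times> (real \<Rightarrow> real)" where
  "noise T \<xi> W \<omega> = (\<xi> \<omega>, \<lambda>t\<in>{0..T}. W t \<omega>)"

text \<open>The filtration generated by \<open>\<xi>\<close> and \<open>W\<close>: completed by the null sets of \<open>M\<close>, then made
  right-continuous on \<open>{0..<T}\<close>.\<close>

definition completed_generated_sets ::
    "'a measure \<Rightarrow> ('a \<Rightarrow> real) \<Rightarrow> (real \<Rightarrow> 'a \<Rightarrow> real) \<Rightarrow> real \<Rightarrow> 'a set set" where
  "completed_generated_sets M \<xi> W t = sigma_sets (space M)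
     ({\<xi> -` A \<inter> space M | A. A \<in> sets borel} \<union>
      {W u -` A \<inter> space M | u A. u \<in> {0..t} \<and> A \<in> sets borel} \<union>
      null_sets M)"

definition generated_filtration ::
    "'a measure \<Rightarrow> real \<Rightarrow> ('a \<Rightarrow> real) \<Rightarrow> (real \<Rightarrow> 'a \<Rightarrow> real) \<Rightarrow> real \<Rightarrow> 'a measure" where
  "generated_filtration M T \<xi> W t = sigma (space M)
     (if t < T then (\<Inter>s\<in>{t<..T}. completed_generated_sets M \<xi> W s)
      else completed_generated_sets M \<xi> W T)"

text \<open>The Borel \<open>\<sigma>\<close>-algebra of \<open>C([0,T])\<close> with the supremum metric.  As usual for
  \<^const>\<open>cfunspace\<close>, its elements take the value \<^const>\<open>undefined\<close> outside \<open>{0..T}\<close>.\<close>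

definition path_borel :: "real \<Rightarrow> (real \<Rightarrow> real) measure" where
  "path_borel T =
     (let C = cfunspace (top_of_set {0..T}) (euclidean_metric :: real metric)
      in sigma (mspace C) {U. openin (mtopology_of C) U})"

definition state ::
    "('a \<Rightarrow> real) \<Rightarrow> (real \<Rightarrow> 'a \<Rightarrow> real) \<Rightarrow> (real \<Rightarrow> 'a \<Rightarrow> real) \<Rightarrow> real \<Rightarrow> 'a \<Rightarrow> real" where
  "state \<xi> W \<alpha> t \<omega> = \<xi> \<omega> + (LBINT s:{0..t}. \<alpha> s \<omega>) + W t \<omega>"

locale emission_game = prob_space M + complete_measure M
  for M :: "'a measure" +
  fixes T a b \<epsilon> :: real
    and F :: "real \<Rightarrow> 'a measure"
    and \<xi> :: "'a \<Rightarrow> real"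
    and W :: "real \<Rightarrow> 'a \<Rightarrow> real"
  assumes T_pos: "T > 0" and a_nonneg: "a \<ge> 0" and b_nonneg: "b \<ge> 0" and \<epsilon>_pos: "\<epsilon> > 0"
    and filtration_F: "filtration_on M T F" and usual_F: "usual_conditions M T F"
    and brownian_W: "brownian_motion M T F W"
    and \<xi>_measurable: "\<xi> \<in> borel_measurable (F 0)"
    and \<xi>_square_integrable: "integrable M (\<lambda>\<omega>. (\<xi> \<omega>)\<^sup>2)"
    and \<xi>_indep_W: "indep_rvs M borel \<xi> (PiM {0..T} (\<lambda>_. borel)) (\<lambda>\<omega>. \<lambda>t\<in>{0..T}. W t \<omega>)"
    and uniform_F0: "\<exists>U :: 'a \<Rightarrow> real. U \<in> borel_measurable (F 0) \<and>
          distr M borel U = uniform_measure lborel {0..1} \<and>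
          indep_rvs M borel U (noise_space T) (noise T \<xi> W)"

text \<open>
  A flow \<open>\<mu>\<close> maps \<open>\<omega>\<close> to a path, so that \<open>\<mu>\<^sub>t\<close> is \<open>\<lambda>\<omega>. \<mu> \<omega> t\<close>.  The Bochner integrals in the
  payoff have the junk value 0 if they do not exist.  For the equilibrium notion below this is
  harmless: condition (ii) gives \<open>E[\<mu>\<^sub>t\<^sup>2] \<le> E[X\<^sub>t\<^sup>2]\<close>, which is bounded in \<open>t\<close>, so all payoffs in
  condition (i) are finite.
\<close>

definition payoff ::
    "'a measure \<Rightarrow> real \<Rightarrow> real \<Rightarrow> real \<Rightarrow> real \<Rightarrow> ('a \<Rightarrow> real) \<Rightarrow> (real \<Rightarrow> 'a \<Rightarrow> real) \<Rightarrow>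
     (real \<Rightarrow> 'a \<Rightarrow> real) \<Rightarrow> ('a \<Rightarrow> real \<Rightarrow> real) \<Rightarrow> real" where
  "payoff M T a b \<epsilon> \<xi> W \<alpha> \<mu> = prob_space.expectation M (\<lambda>\<omega>. LBINT t:{0..T}.
     a * \<mu> \<omega> t - b / 2 * (\<mu> \<omega> t)\<^sup>2 - 1 / 2 * (\<alpha> t \<omega>)\<^sup>2
       - \<epsilon> / 2 * (\<mu> \<omega> t - state \<xi> W \<alpha> t \<omega>)\<^sup>2)"

definition correlated_flow ::
    "'a measure \<Rightarrow> real \<Rightarrow> (real \<Rightarrow> 'a measure) \<Rightarrow> ('a \<Rightarrow> real) \<Rightarrow> (real \<Rightarrow> 'a \<Rightarrow> real) \<Rightarrow>
     (real \<Rightarrow> 'a \<Rightarrow> real) \<Rightarrow> ('a \<Rightarrow> real \<Rightarrow> real) \<Rightarrow> bool" where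
  "correlated_flow M T F \<xi> W \<alpha> \<mu> \<longleftrightarrow>
     \<alpha> \<in> H2 M T F \<and>
     \<mu> \<in> measurable (F 0) (path_borel T) \<and>
     indep_rvs M (path_borel T) \<mu> (noise_space T) (noise T \<xi> W)"

definition mean_field_CCE ::
    "'a measure \<Rightarrow> real \<Rightarrow> real \<Rightarrow> real \<Rightarrow> real \<Rightarrow> (real \<Rightarrow> 'a measure) \<Rightarrow> ('a \<Rightarrow> real) \<Rightarrow>
     (real \<Rightarrow> 'a \<Rightarrow> real) \<Rightarrow> (real \<Rightarrow> 'a \<Rightarrow> real) \<Rightarrow> ('a \<Rightarrow> real \<Rightarrow> real) \<Rightarrow> bool" where
  "mean_field_CCE M T a b \<epsilon> F \<xi> W \<alpha> \<mu> \<longleftrightarrow>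
     correlated_flow M T F \<xi> W \<alpha> \<mu> \<and>
     (\<forall>\<beta> \<in> H2 M T (generated_filtration M T \<xi> W).
        payoff M T a b \<epsilon> \<xi> W \<alpha> \<mu> \<ge> payoff M T a b \<epsilon> \<xi> W \<beta> \<mu>) \<and>
     (\<forall>t\<in>{0..T}. AE \<omega> in M.
        \<mu> \<omega> t =
          real_cond_exp M (vimage_algebra (space M) \<mu> (path_borel T)) (state \<xi> W \<alpha> t) \<omega>)"

definition riccati_solution :: "real \<Rightarrow> real \<Rightarrow> (real \<Rightarrow> real) \<Rightarrow> bool" where
  "riccati_solution T \<epsilon> \<phi> \<longleftrightarrow>
     (\<exists>\<phi>'. \<forall>t\<in>{0..T}. (\<phi> has_real_derivative \<phi>' t) (at t within {0..T}) \<and>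
                       \<phi>' t + \<epsilon> - (\<phi> t)\<^sup>2 = 0) \<and>
     \<phi> T = 0"

text \<open>\<open>(\<alpha>, \<mu>)\<close> lies in the class \<open>\<G>\<^sub>l\<close>, with associated random variable \<open>Z\<close>.  The equation for
  \<open>\<alpha>\<close> is implicit, because \<open>X = X\<^sup>\<alpha>\<close> is the state controlled by \<open>\<alpha>\<close> itself; both equations are
  between processes and hence required to hold outside a null set.\<close>

definition class_Gl ::
    "'a measure \<Rightarrow> real \<Rightarrow> (real \<Rightarrow> 'a measure) \<Rightarrow> ('a \<Rightarrow> real) \<Rightarrow> (real \<Rightarrow> 'a \<Rightarrow> real) \<Rightarrow>
     (real \<Rightarrow> real) \<Rightarrow> (real \<Rightarrow> 'a \<Rightarrow> real) \<Rightarrow> ('a \<Rightarrow> real \<Rightarrow> real) \<Rightarrow> ('a \<Rightarrow> real) \<Rightarrow> bool" where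
  "class_Gl M T F \<xi> W \<phi> \<alpha> \<mu> Z \<longleftrightarrow>
     correlated_flow M T F \<xi> W \<alpha> \<mu> \<and>
     Z \<in> borel_measurable (F 0) \<and>
     integrable M (\<lambda>\<omega>. (Z \<omega>)\<^sup>2) \<and>
     indep_rvs M borel Z (noise_space T) (noise T \<xi> W) \<and>
     (AE \<omega> in M. \<forall>t\<in>{0..T}.
        \<mu> \<omega> t = prob_space.expectation M \<xi> + t * Z \<omega> \<and>
        \<alpha> t \<omega> = \<phi> t * (\<mu> \<omega> t - state \<xi> W \<alpha> t \<omega>) + Z \<omega>)"

definition g_fun :: "real \<Rightarrow> (real \<Rightarrow> real) \<Rightarrow> real \<Rightarrow> real" where
  "g_fun T \<phi> t = (LBINT s:{t..T}. \<phi> s * exp (- (LBINT u:{t..s}. \<phi> u)))"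

definition r_fun :: "real \<Rightarrow> (real \<Rightarrow> real) \<Rightarrow> real \<Rightarrow> real" where
  "r_fun T \<phi> t = (LBINT s:{0..t}. (1 - g_fun T \<phi> s) * exp (- (LBINT u:{s..t}. \<phi> u)))"

definition v_fun :: "(real \<Rightarrow> real) \<Rightarrow> real \<Rightarrow> real" where
  "v_fun \<phi> t = (LBINT s:{0..t}. (s * \<phi> s + 1) * exp (- (LBINT u:{s..t}. \<phi> u)))"

definition c_M :: "real \<Rightarrow> real \<Rightarrow> (real \<Rightarrow> real) \<Rightarrow> real" where
  "c_M T \<epsilon> \<phi> =
     (LBINT t:{0..T}. (\<phi> t * r_fun T \<phi> t + g_fun T \<phi> t)\<^sup>2 + \<epsilon> * (r_fun T \<phi> t)\<^sup>2) - T"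

definition c_V :: "real \<Rightarrow> real \<Rightarrow> (real \<Rightarrow> real) \<Rightarrow> real" where
  "c_V T \<epsilon> \<phi> =
     (LBINT t:{0..T}. (\<phi> t)\<^sup>2 * (v_fun \<phi> t - t)\<^sup>2 + \<epsilon> * (v_fun \<phi> t)\<^sup>2) - T"

end

theory Submission
  imports Defs
begin

text \<open>
  Under \<open>(\<lambda>, \<mu>)\<close> the process \<open>Y = X - \<mu>\<close> solves \<open>dY = -\<phi> Y dt + dW\<close>, \<open>Y\<^sub>0 = \<xi> - \<nu>\<^sub>1\<close>, so it is a centred
  functional of the noise, independent of \<open>\<mu>\<close>, and the consistency condition (ii) always holds.  Put
  \<open>p = \<phi> r + g\<close>; then \<open>r' = 1 - p\<close>, \<open>p' = -\<epsilon> r\<close>, \<open>r\<^sub>0 = p\<^sub>T = 0\<close>, and \<open>v\<^sub>t = t\<close>.  Writing a deviation as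
  \<open>\<beta> = z\<^sub>1 p - \<phi> Y + \<eta>\<close> and \<open>H\<^sub>t = \<integral>\<^sub>0\<^sup>t \<eta>\<^sub>s ds\<close>, one has \<open>X\<^sup>\<beta> - \<mu> = Y + H - z\<^sub>1 r - t (Z - z\<^sub>1)\<close>.  All mixed terms
  in the payoffs cancel in expectation, which leaves
  \<open>2 (J(\<lambda>, \<mu>) - J(\<beta>, \<mu>)) = z\<^sub>1\<^sup>2 c\<^sub>M + \<sigma>\<^sub>z\<^sup>2 c\<^sub>V + E \<integral> (\<eta>\<^sup>2 + \<epsilon> H\<^sup>2) dt\<close>.
  The last term is nonnegative and vanishes for \<open>\<eta> = 0\<close>, which is an admissible deviation.
\<close>

text \<open>A deviating player observes only the noise, so \<open>Z\<close> enters its problem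
  through the mean alone: it tracks the slope \<open>z\<^sub>1\<close> by
  \<open>z\<^sub>1 * p\<close> and bears the error \<open>t * (Z - z\<^sub>1)\<close> in full. Hence
  mean and variance separate, with different constants; the \<open>- T\<close> in both constants is
  the cost of the term \<open>Z\<close> in the recommended control. The cancellations have three
  sources: \<open>Z - z\<^sub>1\<close> is centred and independent of the completed noise,
  \<open>p\<close> is stationary for a deterministic control problem, and \<open>\<eta>\<close> at
  time \<open>s\<close> is uncorrelated with Brownian increments after \<open>s\<close>. The last
  fact would usually be phrased with stochastic integrals. Since the noise is additive, none is
  needed: \<open>Y - W\<close> solves a linear equation path by path, and integration by parts
  leaves ordinary integrals of increments. Deviations live in a completed and right-continuous
  filtration. Only two bounds on it enter the estimates: it stays inside the completed noise at time
  \<open>T\<close>, where independence of \<open>Z\<close> survives, and inside \<open>F t\<close>,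
  which is independent of later increments.\<close>

section \<open>Almost everywhere equality, joint measurability, independence\<close>

text \<open>Preimages under \<open>f\<close> and \<open>g\<close> differ by subsets of a null set,
  and completeness makes these measurable. The states of the game are known only up to such
  sets.\<close>

lemma (in complete_measure) AE_cong_measurable:
  fixes f g :: "'a \<Rightarrow> real"
  assumes AE: "AE x in M. f x = g x" and g: "g \<in> borel_measurable M"
  shows "f \<in> borel_measurable M"
proof (rule measurableI)
  fix A :: "real set" assume A: "A \<in> sets borel"
  have "g -` A \<inter> space M \<in> sets M" using g A by (rule measurable_sets)
  moreover have "AE x in M. x \<in> f -` A \<inter> space M \<longleftrightarrow> x \<in> g -` A \<inter> space M"
    using AE by eventually_elim auto
  ultimately show "f -` A \<inter> space M \<in> sets M"
    by (subst in_sets_AE) auto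
qed auto

text \<open>If one function fails to be measurable, so does the other, and both integrals take the
  default value 0. Payoffs can thus be rewritten before their integrands are known to be
  measurable.\<close>

lemma (in complete_measure) integral_cong_AE_complete:
  fixes f g :: "'a \<Rightarrow> real"
  assumes AE: "AE x in M. f x = g x"
  shows "integral\<^sup>L M f = integral\<^sup>L M g"
proof (cases "g \<in> borel_measurable M")
  case True
  then show ?thesis using AE AE_cong_measurable[OF AE] by (intro integral_cong_AE) auto
next
  case False
  have "AE x in M. g x = f x" using AE by eventually_elim simp
  then have "f \<notin> borel_measurable M" using False AE_cong_measurable by blast
  then have "\<not> integrable M f" "\<not> integrable M g" using False by (auto dest: borel_measurable_integrable)
  then show ?thesis by (simp add: not_integrable_integral_eq)
qed

text \<open>The values at the times \<open>\<lfloor>n s\<rfloor> / n\<close> approximate the process by processes with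
  countably many pieces.\<close>
lemma borel_measurable_pair_continuous:
  fixes f :: "real \<Rightarrow> 'a \<Rightarrow> real"
  assumes meas: "\<And>s. s \<in> {0..t} \<Longrightarrow> f s \<in> borel_measurable N"
    and cont: "\<And>\<omega>. \<omega> \<in> space N \<Longrightarrow> continuous_on {0..t} (\<lambda>s. f s \<omega>)"
  shows "(\<lambda>(s, \<omega>). f s \<omega>) \<in> borel_measurable (restrict_space borel {0..t} \<Otimes>\<^sub>M N)"
proof -
  let ?P = "restrict_space borel {0..t} \<Otimes>\<^sub>M N"
  define q :: "nat \<Rightarrow> real \<Rightarrow> real" where "q n s = of_int \<lfloor>real (Suc n) * s\<rfloor> / real (Suc n)" for n s
  have q_le: "0 \<le> q n s" "q n s \<le> s" "s - q n s \<le> 1 / real (Suc n)" if "0 \<le> s" for n s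
  proof -
    have 1: "of_int \<lfloor>real (Suc n) * s\<rfloor> \<le> real (Suc n) * s" "real (Suc n) * s - of_int \<lfloor>real (Suc n) * s\<rfloor> \<le> 1"
      by linarith+
    show "0 \<le> q n s" using that unfolding q_def by simp
    show "q n s \<le> s" using 1(1) unfolding q_def by (simp add: field_simps)
    have "s - q n s = (real (Suc n) * s - of_int \<lfloor>real (Suc n) * s\<rfloor>) / real (Suc n)"
      unfolding q_def by (simp add: diff_divide_distrib)
    then show "s - q n s \<le> 1 / real (Suc n)" using 1(2) by (simp add: divide_right_mono)
  qed
  have q_tendsto: "(\<lambda>n. q n s) \<longlonglongrightarrow> s" if "0 \<le> s" for s
  proof -
    have "(\<lambda>n. s - q n s) \<longlonglongrightarrow> 0"
      by (rule tendsto_sandwich[OF _ _ tendsto_const LIMSEQ_inverse_real_of_nat])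
         (use q_le[OF that] in \<open>auto simp: inverse_eq_divide\<close>)
    then have "(\<lambda>n. s - (s - q n s)) \<longlonglongrightarrow> s - 0" by (intro tendsto_intros)
    then show ?thesis by simp
  qed
  have m: "(\<lambda>x. f (q n (fst x)) (snd x)) \<in> borel_measurable ?P" for n
  proof -
    \<comment> \<open>The index runs over all integers, but \<open>f\<close> is controlled only at
      times in \<open>{0..t}\<close>; the guard makes every piece measurable. Rounding down keeps
      \<open>q n s\<close> in the interval, so the value 0 never shows up on the space.\<close>
    define h where "h i x = (if of_int i / real (Suc n) \<in> {0..t} then f (of_int i / real (Suc n)) (snd x) else 0)"
      for i :: int and x :: "real \<times> 'a"
    have [measurable]: "h i \<in> borel_measurable ?P" for i
      unfolding h_def using meas by (cases "of_int i / real (Suc n) \<in> {0..t}") auto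
    have [measurable]: "(\<lambda>x. \<lfloor>real (Suc n) * fst x\<rfloor>) \<in> measurable ?P (count_space UNIV)"
    proof -
      have [measurable]: "fst \<in> borel_measurable ?P"
        by (rule measurable_compose[OF measurable_fst]) (simp add: measurable_restrict_space1)
      show ?thesis by measurable
    qed
    have "(\<lambda>x. h \<lfloor>real (Suc n) * fst x\<rfloor> x) \<in> borel_measurable ?P"
      by (rule measurable_compose_countable) measurable
    then show ?thesis
    proof (rule iffD1[OF measurable_cong, rotated])
      fix x assume "x \<in> space ?P"
      then have "0 \<le> fst x" "fst x \<le> t" by (auto simp: space_pair_measure space_restrict_space)
      then have "q n (fst x) \<in> {0..t}" using q_le[of "fst x" n] by auto
      then show "h \<lfloor>real (Suc n) * fst x\<rfloor> x = f (q n (fst x)) (snd x)"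
        unfolding h_def q_def by simp
    qed
  qed
  show ?thesis
  proof (rule borel_measurable_LIMSEQ_real[OF _ m])
    fix x assume "x \<in> space ?P"
    then have x: "0 \<le> fst x" "fst x \<le> t" "snd x \<in> space N"
      by (auto simp: space_pair_measure space_restrict_space)
    have "(\<lambda>n. f (q n (fst x)) (snd x)) \<longlonglongrightarrow> f (fst x) (snd x)"
      using cont[OF x(3)] q_tendsto[OF x(1)] q_le[OF x(1)] x
      by (intro continuous_on_tendsto_compose[OF cont[OF x(3)]] always_eventually)
         (auto intro: order_trans)
    then show "(\<lambda>n. f (q n (fst x)) (snd x)) \<longlonglongrightarrow> (case x of (s, \<omega>) \<Rightarrow> f s \<omega>)"
      by (simp add: case_prod_beta)
  qed
qed

text \<open>The sigma-algebras generated by \<open>f\<close> and \<open>g\<close> lie in those of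
  \<open>A\<close> and \<open>B\<close> and inherit their independence. This form fits hypotheses
  such as independence of \<open>F s\<close> from an increment.\<close>

lemma (in prob_space) indep_set_expectation_mult:
  fixes f g :: "'a \<Rightarrow> real"
  assumes AB: "indep_set (sets A) (sets B)" and A: "space A = space M" and B: "space B = space M"
    and f: "f \<in> borel_measurable A" and g: "g \<in> borel_measurable B"
    and int: "integrable M f" "integrable M g"
  shows "integrable M (\<lambda>\<omega>. f \<omega> * g \<omega>)" "expectation (\<lambda>\<omega>. f \<omega> * g \<omega>) = expectation f * expectation g"
proof -
  have sub: "sigma_sets (space M) {h -` S \<inter> space M | S. S \<in> sets borel} \<subseteq> sets C"
    if "h \<in> borel_measurable C" "space C = space M" for h :: "'a \<Rightarrow> real" and C
    using that measurable_sets[OF that(1)] by (intro sets.sigma_sets_subset[of _ C, simplified that(2)]) auto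
  have "indep_var borel f borel g"
    unfolding indep_var_eq
  proof (intro conjI)
    show "random_variable borel f" "random_variable borel g" using int by auto
    show "indep_set (sigma_sets (space M) {f -` S \<inter> space M | S. S \<in> sets borel})
        (sigma_sets (space M) {g -` S \<inter> space M | S. S \<in> sets borel})"
      using AB sub[OF f A] sub[OF g B] unfolding indep_set_def
      by (rule_tac indep_sets_mono_sets) (auto split: bool.split)
  qed
  then show "integrable M (\<lambda>\<omega>. f \<omega> * g \<omega>)" "expectation (\<lambda>\<omega>. f \<omega> * g \<omega>) = expectation f * expectation g"
    using int by (auto intro: indep_var_integrable indep_var_lebesgue_integral)
qed

lemma integral_eq_integral_Icc:
  fixes f :: "real \<Rightarrow> real"
  assumes "S \<in> sets borel" "\<And>x. x \<in> S \<longleftrightarrow> x \<in> {a..b} \<and> P x"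
  shows "(LBINT x:S. f x) = (\<integral>x. (if P x then f x else 0) \<partial>restrict_space lborel {a..b})"
  unfolding set_lebesgue_integral_def
  by (subst integral_restrict_space) (auto intro!: Bochner_Integration.integral_cong simp: set_lebesgue_integral_def indicator_def assms)

text \<open>Evaluation is 1-Lipschitz for the supremum metric, hence continuous. It makes the flow
  at time \<open>t\<close> measurable for the sigma-algebra generated by the whole path, as
  condition (ii) requires.\<close>

lemma measurable_eval_path_borel:
  assumes t: "t \<in> {0..T}"
  shows "(\<lambda>f. f t) \<in> borel_measurable (path_borel T)"
proof -
  define C where "C = cfunspace (top_of_set {0..T}) (euclidean_metric :: real metric)"
  have sub: "{U. openin (mtopology_of C) U} \<subseteq> Pow (mspace C)"
    using openin_subset[of "mtopology_of C"] by auto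
  have cm: "continuous_map (mtopology_of C) euclidean (\<lambda>f. f t)"
    unfolding mtopology_of_euclidean[symmetric]
  proof -
    have "Lipschitz_continuous_map C (euclidean_metric :: real metric) (\<lambda>f. f t)"
      unfolding Lipschitz_continuous_map_def
    proof (intro conjI exI[of _ 1] ballI)
      fix x y assume xy: "x \<in> mspace C" "y \<in> mspace C"
      have "mdist euclidean_metric (x t) (y t) \<le> mdist C x y"
        using xy t cfunspace_mdist_le[of x "top_of_set {0..T}" "euclidean_metric :: real metric" y "mdist C x y"]
        unfolding C_def by auto
      then show "mdist euclidean_metric (x t) (y t) \<le> 1 * mdist C x y" by simp
    qed auto
    then show "continuous_map (mtopology_of C) (mtopology_of euclidean_metric) (\<lambda>f. f t)"
      by (rule Lipschitz_continuous_imp_continuous_map)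
  qed
  have P: "path_borel T = sigma (mspace C) {U. openin (mtopology_of C) U}"
    unfolding path_borel_def C_def Let_def ..
  show ?thesis
  proof (rule borel_measurableI)
    fix S :: "real set" assume "open S"
    then have "openin (mtopology_of C) {x \<in> topspace (mtopology_of C). x t \<in> S}"
      using openin_continuous_map_preimage[OF cm] by simp
    moreover have "{x \<in> topspace (mtopology_of C). x t \<in> S} = (\<lambda>f. f t) -` S \<inter> space (path_borel T)"
      using sub unfolding P by (auto simp: space_measure_of)
    ultimately show "(\<lambda>f. f t) -` S \<inter> space (path_borel T) \<in> sets (path_borel T)"
      using sub unfolding P by (auto simp: sets_measure_of)
  qed
qed

section \<open>Calculus on compact intervals\<close>

lemma LBINT_Icc_FTC:
  fixes f F :: "real \<Rightarrow> real"
  assumes "a \<le> b" and "\<And>x. x \<in> {a..b} \<Longrightarrow> (F has_real_derivative f x) (at x within {a..b})"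
    and "continuous_on {a..b} f"
  shows "(LBINT x:{a..b}. f x) = F b - F a"
  using integral_FTC_atLeastAtMost[of a b F f] assms
  by (simp add: set_lebesgue_integral_def has_real_derivative_iff_has_vector_derivative)

lemma LBINT_singleton: "(LBINT s:{a}. (f s :: real)) = 0"
  unfolding set_lebesgue_integral_def
  by (rule integral_eq_zero_AE, rule AE_I[where N="{a}"]) (auto simp: indicator_def)

lemma LBINT_Icc_eq_integral:
  fixes f :: "real \<Rightarrow> real"
  assumes f: "set_integrable lborel {a..b} f" and t: "t \<in> {a..b}"
  shows "(LBINT s:{a..t}. f s) = integral {a..t} f"
  using set_borel_integral_eq_integral(2)[OF set_integrable_subset[OF f, of "{a..t}"]] t by auto

lemma has_field_derivative_cong_Icc:
  fixes f h :: "real \<Rightarrow> real"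
  assumes eq: "\<And>x. x \<in> {a..b} \<Longrightarrow> f x = h x" and t: "t \<in> {a..b}"
  shows "(f has_real_derivative D) (at t within {a..b}) \<longleftrightarrow> (h has_real_derivative D) (at t within {a..b})"
  using has_field_derivative_transform_within[OF _ zero_less_one t, of f D h] eq
    has_field_derivative_transform_within[OF _ zero_less_one t, of h D f] by metis

lemma LBINT_Icc_has_derivative:
  fixes f :: "real \<Rightarrow> real"
  assumes f: "continuous_on {a..b} f" and t: "t \<in> {a..b}"
  shows "((\<lambda>t. LBINT s:{a..t}. f s) has_real_derivative f t) (at t within {a..b})"
proof -
  have "((\<lambda>t. integral {a..t} f) has_real_derivative f t) (at t within {a..b})"
    using f t by (rule integral_has_real_derivative)
  then show ?thesis
    by (subst has_field_derivative_cong_Icc[OF LBINT_Icc_eq_integral[OF borel_integrable_atLeastAtMost'[OF f]] t])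
qed

lemma continuous_on_LBINT_Icc:
  fixes f :: "real \<Rightarrow> real"
  assumes f: "set_integrable lborel {a..b} f"
  shows "continuous_on {a..b} (\<lambda>t. LBINT s:{a..t}. f s)"
proof -
  have "f integrable_on {a..b}"
    using set_borel_integral_eq_integral(1)[OF f] .
  then have "continuous_on {a..b} (\<lambda>t. integral {a..t} f)"
    by (rule indefinite_integral_continuous_1)
  then show ?thesis
    by (subst continuous_on_cong[OF refl LBINT_Icc_eq_integral[OF f]])
qed

lemma DERIV_zero_imp_eq_Icc:
  fixes f :: "real \<Rightarrow> real"
  assumes "\<And>x. x \<in> {a..b} \<Longrightarrow> (f has_real_derivative 0) (at x within {a..b})" and "t \<in> {a..b}"
  shows "f t = f a"
proof (rule has_field_derivative_zero_constant[of "{a..b}" f, THEN exE])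
  show "convex {a..b}" by simp
  fix c assume "\<forall>x\<in>{a..b}. f x = c"
  then show ?thesis using assms(2) by auto
qed (use assms in auto)

text \<open>Path continuity gives joint measurability, and integrating out one variable preserves
  measurability in the other. With \<open>N\<close> the sigma-algebra at time \<open>t\<close> this
  yields adapted time integrals.\<close>

lemma measurable_LBINT_continuous:
  fixes f :: "real \<Rightarrow> 'a \<Rightarrow> real"
  assumes "\<And>s. s \<in> {0..t} \<Longrightarrow> f s \<in> borel_measurable N"
    and "\<And>\<omega>. \<omega> \<in> space N \<Longrightarrow> continuous_on {0..t} (\<lambda>s. f s \<omega>)"
  shows "(\<lambda>\<omega>. LBINT s:{0..t}. f s \<omega>) \<in> borel_measurable N"
proof -
  let ?R = "restrict_space lborel {0..t}"
  have "emeasure ?R (space ?R) \<noteq> \<infinity>"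
    by (cases "0 \<le> t") (auto simp: emeasure_restrict_space space_restrict_space)
  then interpret R: finite_measure ?R by (rule finite_measureI)
  have "(\<lambda>(s, \<omega>). f s \<omega>) \<in> borel_measurable (restrict_space borel {0..t} \<Otimes>\<^sub>M N)"
    using assms by (rule borel_measurable_pair_continuous)
  moreover have "sets (restrict_space borel {0..t} \<Otimes>\<^sub>M N) = sets (?R \<Otimes>\<^sub>M N)"
    by (intro sets_pair_measure_cong sets_restrict_space_cong) simp_all
  ultimately have "(\<lambda>(s, \<omega>). f s \<omega>) \<in> borel_measurable (?R \<Otimes>\<^sub>M N)"
    using measurable_cong_sets[OF _ refl] by blast
  then have [measurable]: "(\<lambda>(\<omega>, s). f s \<omega>) \<in> borel_measurable (N \<Otimes>\<^sub>M ?R)"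
    by (subst measurable_pair_swap_iff) simp
  have "(\<lambda>\<omega>. \<integral>s. f s \<omega> \<partial>?R) \<in> borel_measurable N"
    by measurable
  then show ?thesis by (simp add: integral_restrict_space set_lebesgue_integral_def)
qed

section \<open>The deterministic equations\<close>

locale riccati =
  fixes T \<epsilon> :: real and \<phi> :: "real \<Rightarrow> real"
  assumes T_pos: "T > 0" and riccati: "riccati_solution T \<epsilon> \<phi>"
begin

text \<open>\<open>exp (\<Phi> t)\<close> is the integrating factor of all linear equations below;
  it turns the inner integrals of \<open>g_fun\<close>, \<open>r_fun\<close> and
  \<open>v_fun\<close> into differences.\<close>

definition \<Phi> :: "real \<Rightarrow> real" where "\<Phi> t = (LBINT u:{0..t}. \<phi> u)"

abbreviation r :: "real \<Rightarrow> real" where "r \<equiv> r_fun T \<phi>"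
abbreviation g :: "real \<Rightarrow> real" where "g \<equiv> g_fun T \<phi>"

text \<open>The optimal control for following the target \<open>t\<close> from 0: it is the
  stationary point of the integral of \<open>p^2 + \<epsilon> * r^2\<close>, where
  \<open>r t\<close> is \<open>t\<close> minus the integral of \<open>p\<close> up to
  \<open>t\<close>. Its Euler-Lagrange equation is \<open>p' = - \<epsilon> * r\<close> with
  \<open>p T = 0\<close>.\<close>

definition p :: "real \<Rightarrow> real" where "p t = \<phi> t * r t + g t"

text \<open>Variation of constants for \<open>V' = - \<phi> * (V + w)\<close> with initial value
  \<open>x\<close>. For a Brownian path \<open>w\<close>, the sum \<open>V + w\<close> solves
  \<open>dY = - \<phi> Y dt + dw\<close>; subtracting the noise leaves an equation that makes sense
  for any continuous \<open>w\<close>.\<close>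

definition V :: "real \<Rightarrow> (real \<Rightarrow> real) \<Rightarrow> real \<Rightarrow> real" where
  "V x w t = exp (- \<Phi> t) * (x - (LBINT s:{0..t}. exp (\<Phi> s) * \<phi> s * w s))"

lemma \<phi>_T: "\<phi> T = 0"
  using riccati by (simp add: riccati_solution_def)

lemma DERIV_\<phi>: "t \<in> {0..T} \<Longrightarrow> (\<phi> has_real_derivative (\<phi> t)\<^sup>2 - \<epsilon>) (at t within {0..T})"
proof -
  assume t: "t \<in> {0..T}"
  obtain \<phi>' where "(\<phi> has_real_derivative \<phi>' t) (at t within {0..T})" "\<phi>' t + \<epsilon> - (\<phi> t)\<^sup>2 = 0"
    using riccati t unfolding riccati_solution_def by blast
  moreover from this(2) have "\<phi>' t = (\<phi> t)\<^sup>2 - \<epsilon>" by linarith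
  ultimately show ?thesis by simp
qed

lemma continuous_\<phi>: "continuous_on {0..T} \<phi>"
  using DERIV_\<phi> by (rule DERIV_continuous_on)

lemma DERIV_\<Phi>: "t \<in> {0..T} \<Longrightarrow> (\<Phi> has_real_derivative \<phi> t) (at t within {0..T})"
  unfolding \<Phi>_def using LBINT_Icc_has_derivative[OF continuous_\<phi>] by blast

lemma continuous_\<Phi>: "continuous_on {0..T} \<Phi>"
  using DERIV_\<Phi> by (rule DERIV_continuous_on)

lemma LBINT_\<phi>:
  assumes "0 \<le> s" "s \<le> t" "t \<le> T"
  shows "(LBINT u:{s..t}. \<phi> u) = \<Phi> t - \<Phi> s"
proof (rule LBINT_Icc_FTC)
  show "(\<Phi> has_real_derivative \<phi> x) (at x within {s..t})" if "x \<in> {s..t}" for x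
    by (rule DERIV_subset[OF DERIV_\<Phi>]) (use that assms in auto)
  show "continuous_on {s..t} \<phi>"
    by (rule continuous_on_subset[OF continuous_\<phi>]) (use assms in auto)
qed fact

lemma g_eq:
  assumes t: "t \<in> {0..T}"
  shows "g t = 1 - exp (\<Phi> t - \<Phi> T)"
proof -
  have "g t = (LBINT s:{t..T}. \<phi> s * exp (\<Phi> t - \<Phi> s))"
    unfolding g_fun_def
    by (rule set_lebesgue_integral_cong) (use t LBINT_\<phi>[of t] in auto)
  also have "\<dots> = - exp (\<Phi> t - \<Phi> T) - (- exp (\<Phi> t - \<Phi> t))"
  proof (rule LBINT_Icc_FTC)
    fix x assume "x \<in> {t..T}"
    then have [derivative_intros]: "(\<Phi> has_real_derivative \<phi> x) (at x within {t..T})"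
      by (intro DERIV_subset[OF DERIV_\<Phi>]) (use t in auto)
    show "((\<lambda>s. - exp (\<Phi> t - \<Phi> s)) has_real_derivative \<phi> x * exp (\<Phi> t - \<Phi> x)) (at x within {t..T})"
      by (auto intro!: derivative_eq_intros)
  next
    show "continuous_on {t..T} (\<lambda>s. \<phi> s * exp (\<Phi> t - \<Phi> s))"
      using t by (intro continuous_intros continuous_on_subset[OF continuous_\<phi>] continuous_on_subset[OF continuous_\<Phi>]) auto
  qed (use t in auto)
  finally show ?thesis by simp
qed

lemma r_eq:
  assumes t: "t \<in> {0..T}"
  shows "r t = exp (- \<Phi> t) * (LBINT s:{0..t}. exp (\<Phi> s - \<Phi> T) * exp (\<Phi> s))"
proof -
  have "r t = (LBINT s:{0..t}. exp (- \<Phi> t) * (exp (\<Phi> s - \<Phi> T) * exp (\<Phi> s)))"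
    unfolding r_fun_def
  proof (rule set_lebesgue_integral_cong, simp, intro allI impI)
    fix s assume s: "s \<in> {0..t}"
    then have "(LBINT u:{s..t}. \<phi> u) = \<Phi> t - \<Phi> s" "g s = 1 - exp (\<Phi> s - \<Phi> T)"
      using t LBINT_\<phi>[of s t] g_eq[of s] by auto
    then show "(1 - g s) * exp (- (LBINT u:{s..t}. \<phi> u)) = exp (- \<Phi> t) * (exp (\<Phi> s - \<Phi> T) * exp (\<Phi> s))"
      by (simp only:) (simp add: exp_diff exp_minus divide_simps)
  qed
  then show ?thesis by simp
qed

lemma DERIV_g:
  assumes t: "t \<in> {0..T}"
  shows "(g has_real_derivative - \<phi> t * (1 - g t)) (at t within {0..T})"
proof -
  have "((\<lambda>t. 1 - exp (\<Phi> t - \<Phi> T)) has_real_derivative - \<phi> t * (1 - g t)) (at t within {0..T})"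
    by (rule derivative_eq_intros DERIV_\<Phi>[OF t] refl)+ (simp add: g_eq[OF t])
  then show ?thesis
    by (subst has_field_derivative_cong_Icc[OF g_eq t])
qed

lemma DERIV_r:
  assumes t: "t \<in> {0..T}"
  shows "(r has_real_derivative 1 - p t) (at t within {0..T})"
proof -
  have D: "((\<lambda>t. LBINT s:{0..t}. exp (\<Phi> s - \<Phi> T) * exp (\<Phi> s)) has_real_derivative
      exp (\<Phi> t - \<Phi> T) * exp (\<Phi> t)) (at t within {0..T})"
    by (intro LBINT_Icc_has_derivative t continuous_intros continuous_\<Phi>)
  have "((\<lambda>t. exp (- \<Phi> t) * (LBINT s:{0..t}. exp (\<Phi> s - \<Phi> T) * exp (\<Phi> s))) has_real_derivative 1 - p t) (at t within {0..T})"
    by (rule derivative_eq_intros D DERIV_\<Phi>[OF t] refl)+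
       (simp add: p_def r_eq[OF t] g_eq[OF t] algebra_simps exp_minus)
  then show ?thesis
    by (subst has_field_derivative_cong_Icc[OF r_eq t])
qed

text \<open>The Riccati equation makes the feedback form of \<open>p\<close> match the
  Euler-Lagrange equation: in \<open>\<phi>' r + \<phi> r' + g'\<close> the terms
  \<open>\<phi>^2 r\<close>, \<open>\<phi>\<close> and \<open>\<phi> g\<close> cancel.\<close>

lemma DERIV_p:
  assumes t: "t \<in> {0..T}"
  shows "(p has_real_derivative - \<epsilon> * r t) (at t within {0..T})"
  unfolding p_def
  by (rule derivative_eq_intros DERIV_\<phi>[OF t] DERIV_r[OF t] DERIV_g[OF t] refl)+
     (simp add: p_def algebra_simps power2_eq_square)

lemma continuous_r: "continuous_on {0..T} r"
  using DERIV_r by (rule DERIV_continuous_on)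

lemma continuous_p: "continuous_on {0..T} p"
  using DERIV_p by (rule DERIV_continuous_on)

lemma LBINT_p:
  assumes t: "t \<in> {0..T}"
  shows "(LBINT s:{0..t}. p s) = t - r t"
proof -
  have "(LBINT s:{0..t}. p s) = (t - r t) - (0 - r 0)"
  proof (rule LBINT_Icc_FTC)
    fix x assume "x \<in> {0..t}"
    then have "(r has_real_derivative 1 - p x) (at x within {0..t})"
      by (intro DERIV_subset[OF DERIV_r]) (use t in auto)
    then show "((\<lambda>t. t - r t) has_real_derivative p x) (at x within {0..t})"
      by (auto intro!: derivative_eq_intros)
  qed (use t in \<open>auto intro: continuous_on_subset[OF continuous_p]\<close>)
  moreover have "r 0 = 0" by (simp add: r_fun_def LBINT_singleton)
  ultimately show ?thesis by simp
qed

text \<open>\<open>p T = 0\<close> because both \<open>\<phi>\<close> and \<open>g\<close> vanish at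
  \<open>T\<close>. The tail integral is the form that appears after exchanging the time integrals
  in \<open>PI_\<eta>_p\<close>.\<close>

lemma LBINT_\<epsilon>_r:
  assumes t: "t \<in> {0..T}"
  shows "(LBINT s:{t..T}. \<epsilon> * r s) = p t"
proof -
  have "(LBINT s:{t..T}. \<epsilon> * r s) = - p T - (- p t)"
  proof (rule LBINT_Icc_FTC)
    fix x assume "x \<in> {t..T}"
    then have "(p has_real_derivative - \<epsilon> * r x) (at x within {t..T})"
      by (intro DERIV_subset[OF DERIV_p]) (use t in auto)
    then show "((\<lambda>t. - p t) has_real_derivative \<epsilon> * r x) (at x within {t..T})"
      by (auto intro!: derivative_eq_intros)
  qed (use t in \<open>auto intro!: continuous_intros continuous_on_subset[OF continuous_r]\<close>)
  moreover have "p T = 0" using T_pos by (simp add: p_def \<phi>_T g_eq)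
  ultimately show ?thesis by simp
qed

lemma LBINT_minus_T:
  fixes h :: "real \<Rightarrow> real"
  assumes "continuous_on {0..T} h"
  shows "(LBINT t:{0..T}. h t) - T = (LBINT t:{0..T}. h t - 1)"
proof -
  have "(LBINT t:{0..T}. h t - 1) = (LBINT t:{0..T}. h t) - (LBINT t:{0..T}. 1)"
    by (intro set_integral_diff(2) borel_integrable_atLeastAtMost' continuous_intros assms)
  also have "(LBINT t:{0..T}. 1) = T"
    using T_pos by (simp add: set_lebesgue_integral_def)
  finally show ?thesis by simp
qed

lemma c_M_eq: "c_M T \<epsilon> \<phi> = (LBINT t:{0..T}. (p t)\<^sup>2 + \<epsilon> * (r t)\<^sup>2 - 1)"
  unfolding c_M_def p_def[symmetric]
  by (intro LBINT_minus_T continuous_intros continuous_p continuous_r)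

text \<open>\<open>v_fun\<close> is the solution of \<open>v' = \<phi> * (t - v) + 1\<close> from 0,
  which the identity also solves; concretely, the integrand is the derivative of
  \<open>s * exp (\<Phi> s - \<Phi> t)\<close>. Hence the term with \<open>\<phi>^2\<close> drops
  out of \<open>c_V\<close>.\<close>

lemma v_eq:
  assumes t: "t \<in> {0..T}"
  shows "v_fun \<phi> t = t"
proof -
  have "v_fun \<phi> t = (LBINT s:{0..t}. (s * \<phi> s + 1) * exp (\<Phi> s - \<Phi> t))"
    unfolding v_fun_def by (rule set_lebesgue_integral_cong) (use t LBINT_\<phi>[of _ t] in auto)
  also have "\<dots> = t * exp (\<Phi> t - \<Phi> t) - 0 * exp (\<Phi> 0 - \<Phi> t)"
  proof (rule LBINT_Icc_FTC)
    fix x assume "x \<in> {0..t}"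
    then have [derivative_intros]: "(\<Phi> has_real_derivative \<phi> x) (at x within {0..t})"
      by (intro DERIV_subset[OF DERIV_\<Phi>]) (use t in auto)
    show "((\<lambda>s. s * exp (\<Phi> s - \<Phi> t)) has_real_derivative (x * \<phi> x + 1) * exp (\<Phi> x - \<Phi> t)) (at x within {0..t})"
      by (auto intro!: derivative_eq_intros simp: algebra_simps)
  next
    show "continuous_on {0..t} (\<lambda>s. (s * \<phi> s + 1) * exp (\<Phi> s - \<Phi> t))"
      using t by (intro continuous_intros continuous_on_subset[OF continuous_\<phi>] continuous_on_subset[OF continuous_\<Phi>]) auto
  qed (use t in auto)
  finally show ?thesis by simp
qed

lemma c_V_eq: "c_V T \<epsilon> \<phi> = (LBINT t:{0..T}. \<epsilon> * t\<^sup>2 - 1)"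
proof -
  have "c_V T \<epsilon> \<phi> = (LBINT t:{0..T}. \<epsilon> * t\<^sup>2) - T"
    unfolding c_V_def by (subst set_lebesgue_integral_cong[of _ _ _ "\<lambda>t. \<epsilon> * t\<^sup>2"]) (auto simp: v_eq)
  also have "\<dots> = (LBINT t:{0..T}. \<epsilon> * t\<^sup>2 - 1)"
    by (intro LBINT_minus_T continuous_intros)
  finally show ?thesis .
qed

section \<open>The linear equation driven by a continuous path\<close>

lemma V_0: "V x w 0 = x"
  by (simp add: V_def \<Phi>_def LBINT_singleton)

lemma DERIV_V:
  assumes w: "continuous_on {0..T} w" and t: "t \<in> {0..T}"
  shows "(V x w has_real_derivative - \<phi> t * (V x w t + w t)) (at t within {0..T})"
proof -
  have D: "((\<lambda>t. LBINT s:{0..t}. exp (\<Phi> s) * \<phi> s * w s) has_real_derivative exp (\<Phi> t) * \<phi> t * w t) (at t within {0..T})"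
    by (intro LBINT_Icc_has_derivative t continuous_intros continuous_\<Phi> continuous_\<phi> w)
  show ?thesis
    unfolding V_def
    by (rule derivative_eq_intros D DERIV_\<Phi>[OF t] refl)+ (simp add: algebra_simps exp_minus)
qed

lemma continuous_V: "continuous_on {0..T} w \<Longrightarrow> continuous_on {0..T} (V x w)"
  using DERIV_V by (rule DERIV_continuous_on)

text \<open>The difference of two solutions solves the homogeneous equation, so its product with
  \<open>exp \<Phi>\<close> is constant, and it starts at 0.\<close>

lemma V_unique:
  assumes w: "continuous_on {0..T} w"
    and D: "\<And>t. t \<in> {0..T} \<Longrightarrow> (U has_real_derivative - \<phi> t * (U t + w t)) (at t within {0..T})"
    and t: "t \<in> {0..T}"
  shows "U t = V (U 0) w t"
proof -
  have "((\<lambda>t. exp (\<Phi> t) * (U t - V (U 0) w t)) has_real_derivative 0) (at x within {0..T})" if "x \<in> {0..T}" for x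
    by (rule derivative_eq_intros D DERIV_V DERIV_\<Phi> that w refl)+ (simp add: algebra_simps)
  from DERIV_zero_imp_eq_Icc[OF this t] show ?thesis by (simp add: V_0)
qed

text \<open>Pathwise form of an Ito computation. With \<open>Y = w + V\<close> one would have
  \<open>d(\<phi> Y) = - \<epsilon> Y dt + \<phi> dw\<close>, so the left side is the stochastic
  integral of \<open>\<phi>\<close> from \<open>s\<close> to \<open>T\<close>. Integrating by parts
  against \<open>w t - w s\<close>, with \<open>\<phi> T = 0\<close> and
  \<open>\<phi>' = \<phi>^2 - \<epsilon>\<close>, gives the right side. It involves only increments
  of \<open>w\<close> after \<open>s\<close>.\<close>

lemma adjoint_identity:
  assumes w: "continuous_on {0..T} w" and s: "s \<in> {0..T}"
  shows "(LBINT t:{s..T}. \<epsilon> * (w t + V x w t)) - \<phi> s * (w s + V x w s) =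
    - (LBINT t:{s..T}. ((\<phi> t)\<^sup>2 - \<epsilon>) * (w t - w s))"
proof -
  have c: "continuous_on {s..T} \<phi>" "continuous_on {s..T} w" "continuous_on {s..T} (V x w)"
    using s by (auto intro: continuous_on_subset[OF continuous_\<phi>] continuous_on_subset[OF w]
      continuous_on_subset[OF continuous_V[OF w]])
  have "(LBINT t:{s..T}. \<epsilon> * (w t + V x w t)) + (LBINT t:{s..T}. ((\<phi> t)\<^sup>2 - \<epsilon>) * (w t - w s))
      = (LBINT t:{s..T}. \<epsilon> * (w t + V x w t) + ((\<phi> t)\<^sup>2 - \<epsilon>) * (w t - w s))"
    by (intro set_integral_add(2)[symmetric] borel_integrable_atLeastAtMost' continuous_intros c)
  \<comment> \<open>The antiderivative \<open>- \<phi> t * (V x w t + w s)\<close> freezes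
    \<open>w\<close> at time \<open>s\<close>, because \<open>w\<close> itself need not be
    differentiable.\<close>
  also have "\<dots> = - \<phi> T * (V x w T + w s) - (- \<phi> s * (V x w s + w s))"
  proof (rule LBINT_Icc_FTC)
    fix t assume t: "t \<in> {s..T}"
    have D: "(\<phi> has_real_derivative (\<phi> t)\<^sup>2 - \<epsilon>) (at t within {s..T})"
      "(V x w has_real_derivative - \<phi> t * (V x w t + w t)) (at t within {s..T})"
      by (rule DERIV_subset[OF DERIV_\<phi>] DERIV_subset[OF DERIV_V[OF w]]; use t s in auto)+
    show "((\<lambda>t. - \<phi> t * (V x w t + w s)) has_real_derivative
        \<epsilon> * (w t + V x w t) + ((\<phi> t)\<^sup>2 - \<epsilon>) * (w t - w s)) (at t within {s..T})"
      by (rule derivative_eq_intros D refl)+ (simp add: algebra_simps power2_eq_square)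
  qed (use s in \<open>auto intro!: continuous_intros c\<close>)
  finally show ?thesis by (simp add: \<phi>_T algebra_simps)
qed

end

section \<open>Square integrable processes\<close>

text \<open>Cauchy-Schwarz against the constant 1, from expanding the nonnegative integral of
  \<open>(m * f - c)^2\<close> with \<open>m\<close> the total mass and \<open>c\<close> the
  integral of \<open>f\<close>.\<close>

lemma (in finite_measure) integral_square_le:
  fixes f :: "'a \<Rightarrow> real"
  assumes f: "f \<in> borel_measurable M" and f2: "integrable M (\<lambda>x. (f x)\<^sup>2)"
  shows "(\<integral>x. f x \<partial>M)\<^sup>2 \<le> measure M (space M) * (\<integral>x. (f x)\<^sup>2 \<partial>M)"
proof -
  have i: "integrable M f" using f f2 by (rule square_integrable_imp_integrable)
  define m c where "m = measure M (space M)" and "c = (\<integral>x. f x \<partial>M)"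
  have "0 \<le> (\<integral>x. (m * f x - c)\<^sup>2 \<partial>M)" by simp
  also have "\<dots> = (\<integral>x. m\<^sup>2 * (f x)\<^sup>2 - 2 * m * c * f x + c\<^sup>2 \<partial>M)"
    by (simp add: power2_eq_square algebra_simps)
  also have "\<dots> = m\<^sup>2 * (\<integral>x. (f x)\<^sup>2 \<partial>M) - 2 * m * c * c + m * c\<^sup>2"
    using i f2 by (simp add: m_def c_def)
  also have "\<dots> = m * (m * (\<integral>x. (f x)\<^sup>2 \<partial>M) - c\<^sup>2)"
    by (simp add: power2_eq_square algebra_simps)
  finally have 1: "0 \<le> m * (m * (\<integral>x. (f x)\<^sup>2 \<partial>M) - c\<^sup>2)" .
  show ?thesis
  \<comment> \<open>The expansion bounds \<open>m\<close> times the wanted difference, so the factor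
    can be cancelled only for positive mass; on a null space both sides vanish.\<close>
  proof (cases "m = 0")
    case True
    then have "c = 0" unfolding c_def m_def
      by (intro integral_eq_zero_AE AE_I[where N="space M"]) (auto simp: emeasure_eq_measure)
    then show ?thesis using True unfolding m_def c_def by simp
  next
    case False
    then have "m > 0" unfolding m_def by (simp add: order_less_le)
    with 1 show ?thesis unfolding m_def c_def by (simp add: zero_le_mult_iff)
  qed
qed

locale square_integrable_processes = L: finite_measure L + M: finite_measure M
  for L :: "'t measure" and M :: "'a measure"
begin

sublocale pair_sigma_finite L M ..
sublocale LL: pair_sigma_finite L L ..

text \<open>Membership in L2 of the product of time and probability. Joint measurability is built
  in, so that Fubini is available for all products of such processes.\<close>

definition sq :: "('t \<Rightarrow> 'a \<Rightarrow> real) \<Rightarrow> bool" where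
  "sq f \<longleftrightarrow> case_prod f \<in> borel_measurable (L \<Otimes>\<^sub>M M) \<and> integrable (L \<Otimes>\<^sub>M M) (\<lambda>(t, \<omega>). (f t \<omega>)\<^sup>2)"

text \<open>The type of the argument is free: the same notion serves for weights in time and for
  kernels in two time variables.\<close>

definition bdd :: "('s \<Rightarrow> real) \<Rightarrow> 's measure \<Rightarrow> bool" where
  "bdd k N \<longleftrightarrow> k \<in> borel_measurable N \<and> (\<exists>B. \<forall>x\<in>space N. \<bar>k x\<bar> \<le> B)"

lemma bddE:
  assumes "bdd k N"
  obtains B where "k \<in> borel_measurable N" "B > 0" "\<And>x. x \<in> space N \<Longrightarrow> \<bar>k x\<bar> \<le> B"
proof -
  obtain B where "k \<in> borel_measurable N" "\<And>x. x \<in> space N \<Longrightarrow> \<bar>k x\<bar> \<le> B"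
    using assms unfolding bdd_def by blast
  then show thesis by (intro that[of "max B 1"]) (auto simp: le_max_iff_disj)
qed

lemma bdd_mult:
  assumes f: "bdd f N" and h: "bdd h N"
  shows "bdd (\<lambda>x. f x * h x) N"
proof -
  obtain A B where A: "f \<in> borel_measurable N" "A > 0" "\<And>x. x \<in> space N \<Longrightarrow> \<bar>f x\<bar> \<le> A"
    and B: "h \<in> borel_measurable N" "B > 0" "\<And>x. x \<in> space N \<Longrightarrow> \<bar>h x\<bar> \<le> B"
    using bddE[OF f] bddE[OF h] by metis
  have "\<bar>f x * h x\<bar> \<le> A * B" if "x \<in> space N" for x
    unfolding abs_mult using A B that by (intro mult_mono) auto
  then show ?thesis using A(1) B(1) by (auto simp: bdd_def)
qed

lemma sq_measurable: "sq f \<Longrightarrow> case_prod f \<in> borel_measurable (L \<Otimes>\<^sub>M M)"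
  by (simp add: sq_def)

lemma sq_integrable_mult:
  assumes f: "sq f" and h: "sq h"
  shows "integrable (L \<Otimes>\<^sub>M M) (\<lambda>(t, \<omega>). f t \<omega> * h t \<omega>)"
proof (rule Bochner_Integration.integrable_bound)
  show "integrable (L \<Otimes>\<^sub>M M) (\<lambda>x. (case_prod (\<lambda>t \<omega>. (f t \<omega>)\<^sup>2) x) + (case_prod (\<lambda>t \<omega>. (h t \<omega>)\<^sup>2) x))"
    using f h by (auto simp: sq_def)
  show "(\<lambda>(t, \<omega>). f t \<omega> * h t \<omega>) \<in> borel_measurable (L \<Otimes>\<^sub>M M)"
    using sq_measurable[OF f] sq_measurable[OF h] by (simp add: case_prod_beta')
  have "\<bar>x * y\<bar> \<le> x\<^sup>2 + y\<^sup>2" for x y :: real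
  proof -
    have "2 * (\<bar>x\<bar> * \<bar>y\<bar>) \<le> x\<^sup>2 + y\<^sup>2"
      using sum_squares_bound[of "\<bar>x\<bar>" "\<bar>y\<bar>"] by simp
    moreover have "0 \<le> \<bar>x\<bar> * \<bar>y\<bar>" by simp
    ultimately show ?thesis unfolding abs_mult by linarith
  qed
  then show "AE x in L \<Otimes>\<^sub>M M. norm (case x of (t, \<omega>) \<Rightarrow> f t \<omega> * h t \<omega>)
      \<le> norm (case_prod (\<lambda>t \<omega>. (f t \<omega>)\<^sup>2) x + case_prod (\<lambda>t \<omega>. (h t \<omega>)\<^sup>2) x)"
    by (auto simp: case_prod_beta')
qed

lemma sq_add:
  assumes f: "sq f" and h: "sq h"
  shows "sq (\<lambda>t \<omega>. f t \<omega> + h t \<omega>)"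
  unfolding sq_def
proof
  show "case_prod (\<lambda>t \<omega>. f t \<omega> + h t \<omega>) \<in> borel_measurable (L \<Otimes>\<^sub>M M)"
    using sq_measurable[OF f] sq_measurable[OF h] by (simp add: case_prod_beta')
  have "integrable (L \<Otimes>\<^sub>M M) (\<lambda>x. case_prod (\<lambda>t \<omega>. (f t \<omega>)\<^sup>2) x + 2 * case_prod (\<lambda>t \<omega>. f t \<omega> * h t \<omega>) x
      + case_prod (\<lambda>t \<omega>. (h t \<omega>)\<^sup>2) x)"
    using f h sq_integrable_mult[OF f h] by (auto simp: sq_def)
  then show "integrable (L \<Otimes>\<^sub>M M) (\<lambda>(t, \<omega>). (f t \<omega> + h t \<omega>)\<^sup>2)"
    by (simp add: case_prod_beta' power2_sum algebra_simps)
qed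

lemma sq_mult_bdd:
  assumes c: "bdd c L" and f: "sq f"
  shows "sq (\<lambda>t \<omega>. c t * f t \<omega>)"
proof -
  obtain B where c[measurable]: "c \<in> borel_measurable L" and B: "\<And>x. x \<in> space L \<Longrightarrow> \<bar>c x\<bar> \<le> B"
    using bddE[OF c] by metis
  note [measurable] = sq_measurable[OF f]
  show ?thesis
    unfolding sq_def
  proof
    show "integrable (L \<Otimes>\<^sub>M M) (\<lambda>(t, \<omega>). (c t * f t \<omega>)\<^sup>2)"
    proof (rule Bochner_Integration.integrable_bound)
      show "integrable (L \<Otimes>\<^sub>M M) (\<lambda>x. B\<^sup>2 * case_prod (\<lambda>t \<omega>. (f t \<omega>)\<^sup>2) x)"
        using f by (auto simp: sq_def)
      show "AE x in L \<Otimes>\<^sub>M M. norm (case x of (t, \<omega>) \<Rightarrow> (c t * f t \<omega>)\<^sup>2)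
          \<le> norm (B\<^sup>2 * case_prod (\<lambda>t \<omega>. (f t \<omega>)\<^sup>2) x)"
        using B by (intro AE_I2) (auto simp: space_pair_measure power_mult_distrib intro!: mult_right_mono abs_le_square_iff[THEN iffD1] order_trans[OF B abs_ge_self])
    qed measurable
  qed measurable
qed

lemma sq_uminus: "sq f \<Longrightarrow> sq (\<lambda>t \<omega>. - f t \<omega>)"
  by (auto simp: sq_def case_prod_beta')

lemma sq_diff: "sq f \<Longrightarrow> sq h \<Longrightarrow> sq (\<lambda>t \<omega>. f t \<omega> - h t \<omega>)"
  using sq_add[OF _ sq_uminus, of f h] by simp

lemma sq_const_time:
  assumes G[measurable]: "G \<in> borel_measurable M" and G2: "integrable M (\<lambda>\<omega>. (G \<omega>)\<^sup>2)"
  shows "sq (\<lambda>t. G)"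
  unfolding sq_def
proof
  show "integrable (L \<Otimes>\<^sub>M M) (\<lambda>(t, \<omega>). (G \<omega>)\<^sup>2)"
    by (rule Fubini_integrable) (auto simp: G2)
qed measurable

lemma sq_deterministic: "bdd c L \<Longrightarrow> sq (\<lambda>t \<omega>. c t)"
  using sq_mult_bdd[OF _ sq_const_time[of "\<lambda>_. 1"]] by simp

lemma sq_AE_time:
  assumes f: "sq f"
  shows "AE t in L. f t \<in> borel_measurable M \<and> integrable M (\<lambda>\<omega>. (f t \<omega>)\<^sup>2)"
proof -
  have "AE t in L. integrable M (\<lambda>\<omega>. (f t \<omega>)\<^sup>2)"
    using f AE_integrable_fst[of "\<lambda>t \<omega>. (f t \<omega>)\<^sup>2"] unfolding sq_def by auto
  moreover have "AE t in L. f t \<in> borel_measurable M"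
    using measurable_Pair2[OF sq_measurable[OF f]] by (intro AE_I2) auto
  ultimately show ?thesis by eventually_elim auto
qed

lemma sq_path_measurable: "sq f \<Longrightarrow> \<omega> \<in> space M \<Longrightarrow> (\<lambda>t. f t \<omega>) \<in> borel_measurable L"
  using measurable_Pair1[OF sq_measurable] by simp

lemma sq_AE_path:
  assumes f: "sq f"
  shows "AE \<omega> in M. (\<lambda>t. f t \<omega>) \<in> borel_measurable L \<and> integrable L (\<lambda>t. (f t \<omega>)\<^sup>2) \<and> integrable L (\<lambda>t. f t \<omega>)"
proof -
  have "AE \<omega> in M. integrable L (\<lambda>t. (f t \<omega>)\<^sup>2)"
    using f AE_integrable_snd[of "\<lambda>t \<omega>. (f t \<omega>)\<^sup>2"] unfolding sq_def by auto
  moreover have "AE \<omega> in M. (\<lambda>t. f t \<omega>) \<in> borel_measurable L"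
    using sq_path_measurable[OF f] by (intro AE_I2) auto
  ultimately show ?thesis
    by eventually_elim (auto intro: L.square_integrable_imp_integrable)
qed

section \<open>Integral kernels and orthogonality in time\<close>

text \<open>For \<open>\<bar>k\<bar> \<le> B\<close>, Cauchy-Schwarz bounds the squared time
  integral, path by path and uniformly in \<open>t\<close>, by a constant times the integral of the
  squared path. With the indicator of \<open>s \<le> t\<close> this covers primitives of
  controls.\<close>

lemma sq_kernel:
  assumes k: "bdd (\<lambda>(t, s). k t s) (L \<Otimes>\<^sub>M L)" and f: "sq f"
  shows "sq (\<lambda>t \<omega>. \<integral>s. k t s * f s \<omega> \<partial>L)"
proof -
  obtain B where k[measurable]: "(\<lambda>(t, s). k t s) \<in> borel_measurable (L \<Otimes>\<^sub>M L)" and "B > 0"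
    and B: "\<And>t s. t \<in> space L \<Longrightarrow> s \<in> space L \<Longrightarrow> \<bar>k t s\<bar> \<le> B"
    using bddE[OF k] by (metis (no_types, lifting) SigmaI old.prod.case space_pair_measure)
  note [measurable] = sq_measurable[OF f]
  define C where "C = measure L (space L) * B\<^sup>2"
  have C: "0 \<le> C" by (simp add: C_def)
  let ?h = "\<lambda>t \<omega>. \<integral>s. k t s * f s \<omega> \<partial>L"
  have m[measurable]: "case_prod ?h \<in> borel_measurable (L \<Otimes>\<^sub>M M)"
    by measurable
  have path: "AE \<omega> in M. \<forall>t\<in>space L. (?h t \<omega>)\<^sup>2 \<le> C * (\<integral>s. (f s \<omega>)\<^sup>2 \<partial>L)"
    using sq_AE_path[OF f]
  proof eventually_elim
    case (elim \<omega>)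
    then have fm[measurable]: "(\<lambda>t. f t \<omega>) \<in> borel_measurable L" and f2: "integrable L (\<lambda>t. (f t \<omega>)\<^sup>2)" by auto
    show ?case
    proof
      fix t assume t: "t \<in> space L"
      have [measurable]: "k t \<in> borel_measurable L" using measurable_Pair2[OF k t] by simp
      have le: "(k t s * f s \<omega>)\<^sup>2 \<le> B\<^sup>2 * (f s \<omega>)\<^sup>2" if "s \<in> space L" for s
        unfolding power_mult_distrib using B[OF t that] \<open>B > 0\<close>
        by (intro mult_right_mono abs_le_square_iff[THEN iffD1]) auto
      have i: "integrable L (\<lambda>s. (k t s * f s \<omega>)\<^sup>2)"
        by (rule Bochner_Integration.integrable_bound[OF integrable_mult_right[OF f2, of "B\<^sup>2"]]) (use le in auto)
      have "(?h t \<omega>)\<^sup>2 \<le> measure L (space L) * (\<integral>s. (k t s * f s \<omega>)\<^sup>2 \<partial>L)"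
        by (rule L.integral_square_le[OF _ i]) measurable
      also have "\<dots> \<le> measure L (space L) * (\<integral>s. B\<^sup>2 * (f s \<omega>)\<^sup>2 \<partial>L)"
        by (intro mult_left_mono integral_mono i integrable_mult_right f2 le) auto
      finally show "(?h t \<omega>)\<^sup>2 \<le> C * (\<integral>s. (f s \<omega>)\<^sup>2 \<partial>L)" by (simp add: C_def mult.assoc)
    qed
  qed
  have I: "integrable M (\<lambda>\<omega>. \<integral>s. (f s \<omega>)\<^sup>2 \<partial>L)"
    using f integrable_snd[of "\<lambda>t \<omega>. (f t \<omega>)\<^sup>2"] unfolding sq_def by auto
  have "integrable (L \<Otimes>\<^sub>M M) (\<lambda>(t, \<omega>). C * (\<integral>s. (f s \<omega>)\<^sup>2 \<partial>L))"
    by (rule Fubini_integrable) (use I C in \<open>auto simp: abs_mult\<close>)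
  then have "integrable (L \<Otimes>\<^sub>M M) (\<lambda>(t, \<omega>). (?h t \<omega>)\<^sup>2)"
  proof (rule Bochner_Integration.integrable_bound)
    show "AE x in L \<Otimes>\<^sub>M M. norm (case x of (t, \<omega>) \<Rightarrow> (?h t \<omega>)\<^sup>2)
        \<le> norm (case x of (t, \<omega>) \<Rightarrow> C * (\<integral>s. (f s \<omega>)\<^sup>2 \<partial>L))"
    proof (rule AE_pair_measure)
      show "{x \<in> space (L \<Otimes>\<^sub>M M). norm (case x of (t, \<omega>) \<Rightarrow> (?h t \<omega>)\<^sup>2)
        \<le> norm (case x of (t, \<omega>) \<Rightarrow> C * (\<integral>s. (f s \<omega>)\<^sup>2 \<partial>L))} \<in> sets (L \<Otimes>\<^sub>M M)"
        by measurable
      show "AE t in L. AE \<omega> in M. norm (case (t, \<omega>) of (t, \<omega>) \<Rightarrow> (?h t \<omega>)\<^sup>2)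
        \<le> norm (case (t, \<omega>) of (t, \<omega>) \<Rightarrow> C * (\<integral>s. (f s \<omega>)\<^sup>2 \<partial>L))"
      proof (rule AE_I2)
        fix t assume t: "t \<in> space L"
        show "AE \<omega> in M. norm (case (t, \<omega>) of (t, \<omega>) \<Rightarrow> (?h t \<omega>)\<^sup>2)
          \<le> norm (case (t, \<omega>) of (t, \<omega>) \<Rightarrow> C * (\<integral>s. (f s \<omega>)\<^sup>2 \<partial>L))"
          using path by eventually_elim (use C t in \<open>auto simp: abs_mult\<close>)
      qed
    qed
  qed measurable
  then show ?thesis using m by (simp add: sq_def)
qed

text \<open>Fubini, dominated by \<open>B * \<bar>c t * f s\<bar>\<close>: the kernel moves from
  \<open>f\<close> to its adjoint on \<open>c\<close>. For the indicator of
  \<open>s \<le> t\<close>, a primitive starting at 0 becomes a tail integral ending at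
  \<open>T\<close>, which is integration by parts without derivatives.\<close>

lemma integral_kernel_swap:
  assumes k: "bdd (\<lambda>(t, s). k t s) (L \<Otimes>\<^sub>M L)" and c: "integrable L c" and f: "integrable L f"
  shows "(\<integral>t. c t * (\<integral>s. k t s * f s \<partial>L) \<partial>L) = (\<integral>s. f s * (\<integral>t. k t s * c t \<partial>L) \<partial>L)"
proof -
  obtain B where k[measurable]: "(\<lambda>(t, s). k t s) \<in> borel_measurable (L \<Otimes>\<^sub>M L)" and "B > 0"
    and B: "\<And>t s. t \<in> space L \<Longrightarrow> s \<in> space L \<Longrightarrow> \<bar>k t s\<bar> \<le> B"
    using bddE[OF k] by (metis (no_types, lifting) SigmaI old.prod.case space_pair_measure)
  have [measurable]: "c \<in> borel_measurable L" "f \<in> borel_measurable L" using c f by auto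
  have 0: "integrable (L \<Otimes>\<^sub>M L) (\<lambda>(t, s). B * (c t * f s))"
    by (rule LL.Fubini_integrable) (use c f \<open>B > 0\<close> in \<open>auto simp: abs_mult\<close>)
  have i: "integrable (L \<Otimes>\<^sub>M L) (\<lambda>(t, s). c t * (k t s * f s))"
  proof (rule Bochner_Integration.integrable_bound[OF 0])
    show "AE x in L \<Otimes>\<^sub>M L. norm (case x of (t, s) \<Rightarrow> c t * (k t s * f s)) \<le> norm (case x of (t, s) \<Rightarrow> B * (c t * f s))"
    proof (rule AE_I2)
      fix x assume "x \<in> space (L \<Otimes>\<^sub>M L)"
      then obtain t s where x: "x = (t, s)" "t \<in> space L" "s \<in> space L" by (auto simp: space_pair_measure)
      have "\<bar>k t s\<bar> * \<bar>c t * f s\<bar> \<le> B * \<bar>c t * f s\<bar>" using B x by (intro mult_right_mono) auto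
      then show "norm (case x of (t, s) \<Rightarrow> c t * (k t s * f s)) \<le> norm (case x of (t, s) \<Rightarrow> B * (c t * f s))"
        using \<open>B > 0\<close> by (simp add: x abs_mult mult_ac)
    qed
  qed measurable
  have "(\<integral>t. c t * (\<integral>s. k t s * f s \<partial>L) \<partial>L) = (\<integral>t. \<integral>s. c t * (k t s * f s) \<partial>L \<partial>L)"
    by simp
  also have "\<dots> = (\<integral>s. \<integral>t. c t * (k t s * f s) \<partial>L \<partial>L)"
    using LL.integral_fst[OF i] LL.integral_snd[OF i] by simp
  also have "\<dots> = (\<integral>s. f s * (\<integral>t. k t s * c t \<partial>L) \<partial>L)"
    by (simp flip: integral_mult_right_zero add: mult_ac)
  finally show ?thesis .
qed

lemma integral_orthogonal:
  assumes f: "sq f" and h: "sq h"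
    and 0: "AE t in L. (\<integral>\<omega>. f t \<omega> * h t \<omega> \<partial>M) = 0"
  shows "(\<integral>x. (case x of (t, \<omega>) \<Rightarrow> f t \<omega> * h t \<omega>) \<partial>(L \<Otimes>\<^sub>M M)) = 0"
  using integral_fst[OF sq_integrable_mult[OF f h]] integral_eq_zero_AE[OF 0] by simp

text \<open>Fubini, with \<open>G\<close> regarded as a process constant in time. It is applied to
  \<open>G = 1\<close>, \<open>G = \<zeta>\<close> and \<open>G = \<eta> s\<close>.\<close>

lemma expectation_kernel_orthogonal:
  assumes k: "bdd k L" and f: "sq f" and G: "G \<in> borel_measurable M" "integrable M (\<lambda>\<omega>. (G \<omega>)\<^sup>2)"
    and 0: "AE t in L. (\<integral>\<omega>. G \<omega> * f t \<omega> \<partial>M) = 0"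
  shows "(\<integral>\<omega>. G \<omega> * (\<integral>s. k s * f s \<omega> \<partial>L) \<partial>M) = 0"
proof -
  have 1: "sq (\<lambda>t \<omega>. k t * f t \<omega>)" "sq (\<lambda>t. G)"
    using sq_mult_bdd[OF k f] sq_const_time[OF G] by auto
  have "(\<integral>\<omega>. G \<omega> * (\<integral>s. k s * f s \<omega> \<partial>L) \<partial>M) = (\<integral>\<omega>. (\<integral>s. G \<omega> * (k s * f s \<omega>) \<partial>L) \<partial>M)"
    by simp
  also have "\<dots> = (\<integral>x. (case x of (t, \<omega>) \<Rightarrow> G \<omega> * (k t * f t \<omega>)) \<partial>(L \<Otimes>\<^sub>M M))"
    using integral_snd[OF sq_integrable_mult[OF 1(2,1)]] .
  also have "\<dots> = 0"
  proof (rule integral_orthogonal[OF 1(2,1)])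
    show "AE t in L. (\<integral>\<omega>. G \<omega> * (k t * f t \<omega>) \<partial>M) = 0"
      using 0
    proof eventually_elim
      case (elim t)
      have "(\<integral>\<omega>. G \<omega> * (k t * f t \<omega>) \<partial>M) = (\<integral>\<omega>. k t * (G \<omega> * f t \<omega>) \<partial>M)"
        by (simp only: mult.left_commute)
      then show ?case using elim by simp
    qed
  qed
  finally show ?thesis .
qed

end

section \<open>Brownian motion and the noise filtration\<close>

context emission_game
begin

text \<open>One finite time measure for all integrals. Integrals over subintervals are written with
  0-1 kernels against it, which brings them under the kernel lemmas.\<close>

definition Lt :: "real measure" where "Lt = restrict_space lborel {0..T}"

lemma space_Lt[simp]: "space Lt = {0..T}"
  by (simp add: Lt_def space_restrict_space)

lemma sets_Lt: "sets Lt = sets (restrict_space borel {0..T})"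
  unfolding Lt_def by (rule sets_restrict_space_cong) simp

lemma finite_measure_Lt: "finite_measure Lt"
  using T_pos by (intro finite_measureI) (auto simp: Lt_def emeasure_restrict_space space_restrict_space)

sublocale square_integrable_processes Lt M
  using finite_measure_Lt finite_measure_axioms by (rule square_integrable_processes.intro)

lemma LBINT_eq_Lt:
  assumes "S \<in> sets borel" "\<And>x. x \<in> S \<longleftrightarrow> x \<in> {0..T} \<and> P x"
  shows "(LBINT x:S. f x) = (\<integral>x. (if P x then 1 else 0) * (f x :: real) \<partial>Lt)"
  unfolding Lt_def integral_eq_integral_Icc[OF assms]
  by (rule Bochner_Integration.integral_cong) auto

lemma LBINT_0_T: "(LBINT x:{0..T}. f x) = (\<integral>x. (f x :: real) \<partial>Lt)"
  using LBINT_eq_Lt[of "{0..T}" "\<lambda>_. True"] by simp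

lemma LBINT_0_t: "t \<in> {0..T} \<Longrightarrow> (LBINT x:{0..t}. f x) = (\<integral>x. (if x \<le> t then 1 else 0) * (f x :: real) \<partial>Lt)"
  by (rule LBINT_eq_Lt) auto

lemma LBINT_t_T: "t \<in> {0..T} \<Longrightarrow> (LBINT x:{t..T}. f x) = (\<integral>x. (if t \<le> x then 1 else 0) * (f x :: real) \<partial>Lt)"
  by (rule LBINT_eq_Lt) auto

lemma bdd_continuous:
  assumes "continuous_on {0..T} (f :: real \<Rightarrow> real)"
  shows "bdd f Lt"
proof -
  have "f \<in> borel_measurable Lt"
    using borel_measurable_continuous_on_restrict[OF assms] measurable_cong_sets[OF sets_Lt refl] by blast
  moreover have "bounded (f ` {0..T})"
    using compact_continuous_image[OF assms compact_Icc] by (rule compact_imp_bounded)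
  then have "\<exists>B. \<forall>x\<in>{0..T}. \<bar>f x\<bar> \<le> B" by (auto simp: bounded_iff)
  ultimately show ?thesis by (simp add: bdd_def)
qed

lemma bdd_integrable:
  assumes "bdd c Lt"
  shows "integrable Lt c"
proof -
  obtain B where "c \<in> borel_measurable Lt" "\<And>x. x \<in> space Lt \<Longrightarrow> \<bar>c x\<bar> \<le> B"
    using bddE[OF assms] by metis
  then show ?thesis by (intro L.integrable_const_bound[of _ B] AE_I2) auto
qed

lemma measurable_Lt[measurable]: "(\<lambda>x. x) \<in> borel_measurable Lt"
  unfolding Lt_def by (intro measurable_restrict_space1) simp

lemma bdd_kernel: "bdd (\<lambda>(t, s). if s \<le> t then 1 else 0) (Lt \<Otimes>\<^sub>M Lt)"
  unfolding bdd_def by (intro conjI exI[of _ 1]) (auto simp: case_prod_beta')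

lemma sq_LBINT:
  assumes "sq f"
  shows "sq (\<lambda>t \<omega>. \<integral>s. (if s \<le> t then 1 else 0) * f s \<omega> \<partial>Lt)"
  using sq_kernel[OF bdd_kernel assms] by simp

lemma bdd_indicator_le: "bdd (\<lambda>s. if s \<le> t then 1 else 0) Lt"
  unfolding bdd_def by (intro conjI exI[of _ 1]) auto

lemma AE_Lt_const: "(AE t in Lt. P) \<longleftrightarrow> P"
proof -
  have "emeasure Lt (space Lt) \<noteq> 0"
    using T_pos by (simp add: Lt_def emeasure_restrict_space)
  then show ?thesis
    by (intro eventually_const) (simp add: ae_filter_eq_bot_iff)
qed

lemma sq_cong:
  assumes "\<And>t \<omega>. t \<in> {0..T} \<Longrightarrow> \<omega> \<in> space M \<Longrightarrow> f t \<omega> = h t \<omega>"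
  shows "sq f \<longleftrightarrow> sq h"
  unfolding sq_def
  by (intro arg_cong2[of _ _ _ _ "(\<and>)"] measurable_cong Bochner_Integration.integrable_cong)
     (auto simp: space_pair_measure assms)

text \<open>Viewed as a process constant in time, the integral is square integrable at almost every
  time; \<open>Lt\<close> has positive mass, so a property independent of time then holds
  outright.\<close>

lemma sq_time_integral:
  assumes k: "bdd k Lt" and f: "sq f"
  shows "(\<lambda>\<omega>. \<integral>s. k s * f s \<omega> \<partial>Lt) \<in> borel_measurable M"
    "integrable M (\<lambda>\<omega>. (\<integral>s. k s * f s \<omega> \<partial>Lt)\<^sup>2)"
proof -
  have "bdd (\<lambda>(t, s). k s) (Lt \<Otimes>\<^sub>M Lt)"
    using k unfolding bdd_def by (auto simp: space_pair_measure)
  then have "sq (\<lambda>t \<omega>. \<integral>s. k s * f s \<omega> \<partial>Lt)"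
    using sq_kernel[OF _ f, of "\<lambda>t s. k s"] by simp
  from sq_AE_time[OF this]
  show "(\<lambda>\<omega>. \<integral>s. k s * f s \<omega> \<partial>Lt) \<in> borel_measurable M"
    "integrable M (\<lambda>\<omega>. (\<integral>s. k s * f s \<omega> \<partial>Lt)\<^sup>2)"
    unfolding AE_Lt_const by auto
qed

lemma F_subalgebra: "t \<in> {0..T} \<Longrightarrow> subalgebra M (F t)"
  using filtration_F by (simp add: filtration_on_def)

lemma space_F: "t \<in> {0..T} \<Longrightarrow> space (F t) = space M"
  using F_subalgebra by (simp add: subalgebra_def)

lemma F_mono: "0 \<le> s \<Longrightarrow> s \<le> t \<Longrightarrow> t \<le> T \<Longrightarrow> sets (F s) \<subseteq> sets (F t)"
  using filtration_F by (simp add: filtration_on_def)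

lemma null_sets_F: "t \<in> {0..T} \<Longrightarrow> null_sets M \<subseteq> sets (F t)"
  using usual_F F_mono[of 0 t] by (auto simp: usual_conditions_def)

lemma W_measurable_F: "t \<in> {0..T} \<Longrightarrow> W t \<in> borel_measurable (F t)"
  using brownian_W by (simp add: brownian_motion_def)

lemma W_measurable: "t \<in> {0..T} \<Longrightarrow> W t \<in> borel_measurable M"
  using W_measurable_F measurable_from_subalg[OF F_subalgebra] by blast

lemma zero_in: "0 \<in> {0..T}" using T_pos by simp

lemma \<xi>_measurable_M: "\<xi> \<in> borel_measurable M"
  using \<xi>_measurable measurable_from_subalg[OF F_subalgebra[OF zero_in]] by blast

lemma \<xi>_integrable: "integrable M \<xi>"
  using \<xi>_measurable_M \<xi>_square_integrable by (rule square_integrable_imp_integrable)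

section \<open>The noise sigma-algebra, its completion and the deviation filtration\<close>

abbreviation noise_sets :: "'a set set" where
  "noise_sets \<equiv> sets (vimage_algebra (space M) (noise T \<xi> W) (noise_space T))"

abbreviation CG :: "real \<Rightarrow> 'a set set" where
  "CG \<equiv> completed_generated_sets M \<xi> W"

text \<open>Joint measurability of the pair is part of its independence from the uniform
  variable.\<close>

lemma noise_measurable: "noise T \<xi> W \<in> measurable M (noise_space T)"
  using uniform_F0 by (auto simp: indep_rvs_def)

lemma noise_sets_subset: "noise_sets \<subseteq> sets M"
proof -
  have "space (noise_space T) = UNIV \<times> ({0..T} \<rightarrow>\<^sub>E UNIV)"
    by (simp add: noise_space_def space_pair_measure space_PiM)
  then have "noise T \<xi> W \<in> space M \<rightarrow> space (noise_space T)"
    by (auto simp: noise_def)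
  then show ?thesis
    using measurable_sets[OF noise_measurable] by (auto simp: sets_vimage_algebra2)
qed

lemma noise_measurable_N: "noise T \<xi> W \<in> measurable (vimage_algebra (space M) (noise T \<xi> W) (noise_space T)) (noise_space T)"
  using noise_measurable by (intro measurable_vimage_algebra1) (auto dest: measurable_space)

lemma \<xi>_noise_measurable: "\<xi> \<in> borel_measurable (vimage_algebra (space M) (noise T \<xi> W) (noise_space T))"
proof -
  have "(\<lambda>\<omega>. fst (noise T \<xi> W \<omega>)) \<in> borel_measurable (vimage_algebra (space M) (noise T \<xi> W) (noise_space T))"
    by (rule measurable_compose[OF noise_measurable_N]) (simp add: noise_space_def)
  then show ?thesis by (simp add: noise_def)
qed

lemma W_noise_measurable:
  assumes "t \<in> {0..T}"
  shows "W t \<in> borel_measurable (vimage_algebra (space M) (noise T \<xi> W) (noise_space T))"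
proof -
  have "(\<lambda>x. snd x t) \<in> borel_measurable (noise_space T)"
    unfolding noise_space_def using assms by (intro measurable_compose[OF measurable_snd] measurable_component_singleton)
  then have "(\<lambda>\<omega>. snd (noise T \<xi> W \<omega>) t) \<in> borel_measurable (vimage_algebra (space M) (noise T \<xi> W) (noise_space T))"
    by (rule measurable_compose[OF noise_measurable_N])
  then show ?thesis using assms by (simp add: noise_def)
qed

text \<open>Completion changes events only by null sets, a null event being represented by
  \<open>{}\<close>. The induction carries measurability along with the representation. Independence
  is assumed for the uncompleted noise; this is the bridge to the completed one.\<close>

lemma CG_noise:
  assumes t: "t \<in> {0..T}" and B: "B \<in> CG t"
  shows "B \<in> sets M \<and> (\<exists>B'\<in>noise_sets. AE \<omega> in M. \<omega> \<in> B \<longleftrightarrow> \<omega> \<in> B')"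
  using B unfolding completed_generated_sets_def
proof (induction rule: sigma_sets.induct)
  let ?N = "vimage_algebra (space M) (noise T \<xi> W) (noise_space T)"
  case (Basic B)
  then consider A where "A \<in> sets borel" "B = \<xi> -` A \<inter> space M"
    | u A where "u \<in> {0..t}" "A \<in> sets borel" "B = W u -` A \<inter> space M" | "B \<in> null_sets M"
    by auto
  then show ?case
  proof cases
    case 1
    then have "B \<in> noise_sets" using measurable_sets[OF \<xi>_noise_measurable] by auto
    then show ?thesis using noise_sets_subset by blast
  next
    case 2
    then have "B \<in> noise_sets" using measurable_sets[OF W_noise_measurable, of u A] t by auto
    then show ?thesis using noise_sets_subset by blast
  next
    case 3
    then have "AE \<omega> in M. \<omega> \<in> B \<longleftrightarrow> \<omega> \<in> {}" using AE_not_in by auto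
    then show ?thesis using 3 by (auto intro!: bexI[of _ "{}"])
  qed
next
  case Empty
  show ?case by (auto intro!: bexI[of _ "{}"])
next
  case (Compl B)
  then obtain B' where B': "B' \<in> noise_sets" "AE \<omega> in M. \<omega> \<in> B \<longleftrightarrow> \<omega> \<in> B'" and "B \<in> sets M" by auto
  have "space M - B' \<in> noise_sets" using sets.compl_sets[OF B'(1)] by simp
  moreover have "AE \<omega> in M. \<omega> \<in> space M - B \<longleftrightarrow> \<omega> \<in> space M - B'"
    using B'(2) by eventually_elim auto
  moreover have "space M - B \<in> sets M" using \<open>B \<in> sets M\<close> by auto
  ultimately show ?case by blast
next
  case (Union B)
  then obtain B' where B': "\<And>i. B' i \<in> noise_sets" "\<And>i. AE \<omega> in M. \<omega> \<in> B i \<longleftrightarrow> \<omega> \<in> B' i"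
    and "\<And>i. B i \<in> sets M" by metis
  have "AE \<omega> in M. \<forall>i. \<omega> \<in> B i \<longleftrightarrow> \<omega> \<in> B' i" using B'(2) by (simp add: AE_all_countable)
  then have "AE \<omega> in M. \<omega> \<in> (\<Union>i. B i) \<longleftrightarrow> \<omega> \<in> (\<Union>i. B' i)" by eventually_elim auto
  moreover have "(\<Union>i. B' i) \<in> noise_sets" using B'(1) by auto
  moreover have "(\<Union>i. B i) \<in> sets M" using \<open>\<And>i. B i \<in> sets M\<close> by auto
  ultimately show ?case by blast
qed

lemma CG_subset_M: "t \<in> {0..T} \<Longrightarrow> CG t \<subseteq> sets M"
  using CG_noise by blast

lemma CG_generators_subset:
  "{\<xi> -` A \<inter> space M | A. A \<in> sets borel} \<union> {W u -` A \<inter> space M | u A. u \<in> {0..t} \<and> A \<in> sets borel} \<union> null_sets M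
    \<subseteq> Pow (space M)"
  using sets.sets_into_space by auto

text \<open>The noise filtration before taking right limits. It is convenient for explicit
  processes, and \<open>GF t\<close> lies between \<open>Gm t\<close> and
  \<open>Gm T\<close>.\<close>

definition Gm :: "real \<Rightarrow> 'a measure" where "Gm t = sigma (space M) (CG t)"

lemma space_Gm[simp]: "space (Gm t) = space M"
  by (simp add: Gm_def space_measure_of_conv)

lemma sets_Gm: "sets (Gm t) = CG t"
proof -
  have 1: "CG t \<subseteq> Pow (space M)"
    unfolding completed_generated_sets_def using sigma_sets_into_sp[OF CG_generators_subset] by blast
  show ?thesis unfolding Gm_def sets_measure_of[OF 1]
    unfolding completed_generated_sets_def by (rule sigma_sets_sigma_sets_eq[OF CG_generators_subset])
qed

lemma CG_mono: "s \<le> t \<Longrightarrow> CG s \<subseteq> CG t"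
  unfolding completed_generated_sets_def by (intro sigma_sets_mono' Un_mono order_refl) force

lemma CG_subset_F:
  assumes t: "t \<in> {0..T}"
  shows "CG t \<subseteq> sets (F t)"
proof -
  have "\<xi> -` A \<inter> space M \<in> sets (F t)" if "A \<in> sets borel" for A
    using measurable_sets[OF \<xi>_measurable that] F_mono[of 0 t] t space_F[OF zero_in] by auto
  moreover have "W u -` A \<inter> space M \<in> sets (F t)" if "A \<in> sets borel" "u \<in> {0..t}" for A u
    using measurable_sets[OF W_measurable_F that(1), of u] F_mono[of u t] t that(2) space_F[of u] by auto
  ultimately show ?thesis
    unfolding completed_generated_sets_def space_F[OF t, symmetric]
    using null_sets_F[OF t] by (intro sets.sigma_sets_subset) (auto simp: space_F[OF t])
qed

abbreviation GF :: "real \<Rightarrow> 'a measure" where "GF \<equiv> generated_filtration M T \<xi> W"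

lemma sets_GF:
  assumes t: "t \<in> {0..T}"
  shows "sets (GF t) = sigma_sets (space M) (if t < T then \<Inter>s\<in>{t<..T}. CG s else CG T)"
proof -
  have "(\<Inter>s\<in>{t<..T}. CG s) \<subseteq> CG T" if "t < T" using that by auto
  then have "(if t < T then \<Inter>s\<in>{t<..T}. CG s else CG T) \<subseteq> Pow (space M)"
    using CG_subset_M[of T] T_pos sets.sets_into_space[of _ M] by auto
  then show ?thesis unfolding generated_filtration_def by (rule sets_measure_of)
qed

lemma space_GF[simp]: "space (GF t) = space M"
  by (simp add: generated_filtration_def space_measure_of_conv)

lemma Gm_subset_GF:
  assumes t: "t \<in> {0..T}"
  shows "sets (Gm t) \<subseteq> sets (GF t)"
proof -
  have "CG t \<subseteq> (if t < T then \<Inter>s\<in>{t<..T}. CG s else CG T)"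
  proof (cases "t < T")
    case True
    moreover have "CG t \<subseteq> (\<Inter>s\<in>{t<..T}. CG s)" by (intro INT_greatest CG_mono) simp
    ultimately show ?thesis by simp
  next
    case False
    then show ?thesis using t by simp
  qed
  then show ?thesis unfolding sets_GF[OF t] sets_Gm by (auto intro: sigma_sets.Basic)
qed

text \<open>The crude bound by the terminal sigma-algebra is enough for independence of
  \<open>Z\<close>, where time does not matter.\<close>

lemma GF_subset_Gm:
  assumes t: "t \<in> {0..T}"
  shows "sets (GF t) \<subseteq> sets (Gm T)"
proof -
  have "(if t < T then \<Inter>s\<in>{t<..T}. CG s else CG T) \<subseteq> sets (Gm T)"
    by (auto simp: sets_Gm)
  then show ?thesis unfolding sets_GF[OF t] by (intro sets.sigma_sets_subset[of _ "Gm T", simplified])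
qed

text \<open>\<open>F\<close> contains the null sets and is right-continuous, so it absorbs both the
  completion and the right limit. This keeps a deviation at time \<open>s\<close> independent of the
  increments after \<open>s\<close>, although its sigma-algebra looks infinitesimally ahead.\<close>

lemma GF_subset_F:
  assumes t: "t \<in> {0..T}"
  shows "sets (GF t) \<subseteq> sets (F t)"
proof -
  have "(if t < T then \<Inter>s\<in>{t<..T}. CG s else CG T) \<subseteq> sets (F t)"
  proof (cases "t < T")
    case True
    then have "sets (F t) = (\<Inter>s\<in>{t<..T}. sets (F s))"
      using usual_F t by (simp add: usual_conditions_def)
    moreover have "(\<Inter>s\<in>{t<..T}. CG s) \<subseteq> (\<Inter>s\<in>{t<..T}. sets (F s))"

    proof (rule INT_greatest)
      fix s assume s: "s \<in> {t<..T}"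
      then have "(\<Inter>s\<in>{t<..T}. CG s) \<subseteq> CG s" by (rule INT_lower)
      also have "CG s \<subseteq> sets (F s)" using s t by (intro CG_subset_F) auto
      finally show "(\<Inter>s\<in>{t<..T}. CG s) \<subseteq> sets (F s)" .
    qed
    ultimately show ?thesis using True by simp
  next
    case False
    then show ?thesis using t CG_subset_F[of T] by simp
  qed
  then show ?thesis
    unfolding sets_GF[OF t] space_F[OF t, symmetric] by (rule sets.sigma_sets_subset)
qed

section \<open>Continuous version of the Brownian motion\<close>

text \<open>Discontinuous paths are replaced by 0, so that the pathwise equations apply to every
  outcome. The change depends on the whole path, yet it stays adapted because the exceptional set is
  null and every \<open>Gm t\<close> contains the null sets.\<close>

definition Wc :: "real \<Rightarrow> 'a \<Rightarrow> real" where
  "Wc t \<omega> = (if continuous_on {0..T} (\<lambda>t. W t \<omega>) then W t \<omega> else 0)"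

lemma continuous_Wc: "continuous_on {0..T} (\<lambda>t. Wc t \<omega>)"
  unfolding Wc_def by (cases "continuous_on {0..T} (\<lambda>t. W t \<omega>)") auto

lemma AE_Wc: "AE \<omega> in M. \<forall>t. Wc t \<omega> = W t \<omega>"
proof -
  have "AE \<omega> in M. continuous_on {0..T} (\<lambda>t. W t \<omega>)"
    using brownian_W by (simp add: brownian_motion_def)
  then show ?thesis by eventually_elim (simp add: Wc_def)
qed

lemma generators_in_Gm:
  "A \<in> sets borel \<Longrightarrow> \<xi> -` A \<inter> space M \<in> sets (Gm t)"
  "u \<in> {0..t} \<Longrightarrow> A \<in> sets borel \<Longrightarrow> W u -` A \<inter> space M \<in> sets (Gm t)"
  "N \<in> null_sets M \<Longrightarrow> N \<in> sets (Gm t)"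
  unfolding sets_Gm completed_generated_sets_def by (rule sigma_sets.Basic; blast)+

lemma \<xi>_measurable_Gm: "\<xi> \<in> borel_measurable (Gm t)"
  by (rule measurableI) (auto intro: generators_in_Gm)

lemma Wc_measurable_Gm:
  assumes u: "u \<in> {0..t}"
  shows "Wc u \<in> borel_measurable (Gm t)"
proof -
  have W: "W u \<in> borel_measurable (Gm t)"
    using generators_in_Gm(2)[OF u] by (intro measurableI) auto
  have "AE \<omega> in M. continuous_on {0..T} (\<lambda>t. W t \<omega>)"
    using brownian_W by (simp add: brownian_motion_def)
  \<comment> \<open>Completeness puts the exceptional set itself among the null sets; continuity of
    a path is not an event given by countably many coordinates.\<close>
  then have N: "{\<omega> \<in> space M. \<not> continuous_on {0..T} (\<lambda>t. W t \<omega>)} \<in> sets (Gm t)"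
    unfolding AE_iff_null_sets by (rule generators_in_Gm)
  have "space (Gm t) - {\<omega> \<in> space M. \<not> continuous_on {0..T} (\<lambda>t. W t \<omega>)} \<in> sets (Gm t)"
    using N by (rule sets.compl_sets)
  also have "space (Gm t) - {\<omega> \<in> space M. \<not> continuous_on {0..T} (\<lambda>t. W t \<omega>)}
      = {\<omega> \<in> space (Gm t). continuous_on {0..T} (\<lambda>t. W t \<omega>)}" by auto
  finally show ?thesis unfolding Wc_def using W by (intro measurable_If) auto
qed

lemma subalgebra_Gm: "t \<in> {0..T} \<Longrightarrow> subalgebra M (Gm t)"
  using CG_subset_M by (simp add: subalgebra_def sets_Gm)

lemma subalgebra_F_Gm: "t \<in> {0..T} \<Longrightarrow> subalgebra (F t) (Gm t)"
  using CG_subset_F by (simp add: subalgebra_def sets_Gm space_F)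

lemma subalgebra_GF_Gm: "t \<in> {0..T} \<Longrightarrow> subalgebra (GF t) (Gm t)"
  using Gm_subset_GF by (simp add: subalgebra_def)

lemma subalgebra_Gm_GF: "t \<in> {0..T} \<Longrightarrow> subalgebra (Gm T) (GF t)"
  using GF_subset_Gm by (simp add: subalgebra_def)

lemma subalgebra_F_GF: "t \<in> {0..T} \<Longrightarrow> subalgebra (F t) (GF t)"
  using GF_subset_F by (simp add: subalgebra_def space_F)

lemma T_in: "T \<in> {0..T}" using T_pos by simp

lemma measurable_Gm_M: "f \<in> borel_measurable (Gm T) \<Longrightarrow> f \<in> borel_measurable M"
  using measurable_from_subalg[OF subalgebra_Gm[OF T_in]] .

lemma Wc_measurable: "t \<in> {0..T} \<Longrightarrow> Wc t \<in> borel_measurable M"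
  using Wc_measurable_Gm[of t T] measurable_Gm_M by blast

lemma brownian_increment:
  assumes s: "s \<in> {0..T}" and t: "t \<in> {s<..T}"
  shows "integrable M (\<lambda>\<omega>. W t \<omega> - W s \<omega>)" "expectation (\<lambda>\<omega>. W t \<omega> - W s \<omega>) = 0"
    "integrable M (\<lambda>\<omega>. (W t \<omega> - W s \<omega>)\<^sup>2)" "expectation (\<lambda>\<omega>. (W t \<omega> - W s \<omega>)\<^sup>2) = t - s"
    "indep_set (sets (F s)) (sets (vimage_algebra (space M) (\<lambda>\<omega>. W t \<omega> - W s \<omega>) borel))"
proof -
  have D: "distributed M lborel (\<lambda>\<omega>. W t \<omega> - W s \<omega>) (normal_density 0 (sqrt (t - s)))"
    and ind: "indep_set (sets (F s)) (sets (vimage_algebra (space M) (\<lambda>\<omega>. W t \<omega> - W s \<omega>) borel))"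
    using brownian_W s t by (auto simp: brownian_motion_def)
  have pos: "0 < sqrt (t - s)" using t by simp
  show "indep_set (sets (F s)) (sets (vimage_algebra (space M) (\<lambda>\<omega>. W t \<omega> - W s \<omega>) borel))" by fact
  show "integrable M (\<lambda>\<omega>. W t \<omega> - W s \<omega>)"
    using distributed_integrable[OF D, of "\<lambda>x. x"] integrable_normal_moment[OF pos, of 0 1] by simp
  show "expectation (\<lambda>\<omega>. W t \<omega> - W s \<omega>) = 0"
    using distributed_integral[OF D, of "\<lambda>x. x"] integral_normal_moment_odd[OF pos, of 0 0] by simp
  show "integrable M (\<lambda>\<omega>. (W t \<omega> - W s \<omega>)\<^sup>2)"
    using distributed_integrable[OF D, of "\<lambda>x. x\<^sup>2"] integrable_normal_moment[OF pos, of 0 2] by simp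
  show "expectation (\<lambda>\<omega>. (W t \<omega> - W s \<omega>)\<^sup>2) = t - s"
    using distributed_integral[OF D, of "\<lambda>x. x\<^sup>2"] integral_normal_moment_even[OF pos, of 0 1] t by simp
qed

lemma Wc_moments:
  assumes t: "t \<in> {0..T}"
  shows "integrable M (Wc t)" "expectation (Wc t) = 0"
    "integrable M (\<lambda>\<omega>. (Wc t \<omega>)\<^sup>2)" "expectation (\<lambda>\<omega>. (Wc t \<omega>)\<^sup>2) = t"
proof -
  \<comment> \<open>The definition of Brownian motion gives laws only for increments over intervals
    of positive length, so time 0 is treated apart.\<close>
  define h where "h \<omega> = (if t = 0 then 0 else W t \<omega> - W 0 \<omega>)" for \<omega>
  have [measurable]: "Wc t \<in> borel_measurable M" "W t \<in> borel_measurable M" "W 0 \<in> borel_measurable M"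
    using Wc_measurable[OF t] W_measurable[OF t] W_measurable[OF zero_in] by auto
  have [measurable]: "h \<in> borel_measurable M" unfolding h_def by measurable
  have "AE \<omega> in M. W 0 \<omega> = 0" using brownian_W by (simp add: brownian_motion_def)
  with AE_Wc have eq: "AE \<omega> in M. Wc t \<omega> = h \<omega>"
    by eventually_elim (auto simp: h_def)
  then have eq2: "AE \<omega> in M. (Wc t \<omega>)\<^sup>2 = (h \<omega>)\<^sup>2" by eventually_elim simp
  have "integrable M h \<and> expectation h = 0 \<and> integrable M (\<lambda>\<omega>. (h \<omega>)\<^sup>2) \<and> expectation (\<lambda>\<omega>. (h \<omega>)\<^sup>2) = t"
    using brownian_increment[OF zero_in, of t] t unfolding h_def by (cases "t = 0") auto
  then show "integrable M (Wc t)" "expectation (Wc t) = 0"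
    "integrable M (\<lambda>\<omega>. (Wc t \<omega>)\<^sup>2)" "expectation (\<lambda>\<omega>. (Wc t \<omega>)\<^sup>2) = t"
    using integrable_cong_AE[OF _ _ eq] integral_cong_AE[OF _ _ eq]
      integrable_cong_AE[OF _ _ eq2] integral_cong_AE[OF _ _ eq2] by auto
qed

lemma case_prod_measurable_Lt:
  assumes "(\<lambda>(s, \<omega>). f s \<omega>) \<in> borel_measurable (restrict_space borel {0..T} \<Otimes>\<^sub>M N)"
    and "subalgebra M N"
  shows "case_prod f \<in> borel_measurable (Lt \<Otimes>\<^sub>M M)"
proof -
  have "(\<lambda>x. x) \<in> measurable Lt (restrict_space borel {0..T})"
    using measurable_cong_sets[OF sets_Lt refl, of "restrict_space borel {0..T}"] by (auto intro: measurable_ident)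
  moreover have "(\<lambda>x. x) \<in> measurable M N"
    using assms(2) by (auto simp: subalgebra_def measurable_def sets.sets_into_space)
  ultimately have "(\<lambda>(s, \<omega>). (s, \<omega>)) \<in> measurable (Lt \<Otimes>\<^sub>M M) (restrict_space borel {0..T} \<Otimes>\<^sub>M N)"
    unfolding case_prod_beta' by (intro measurable_Pair measurable_compose[OF measurable_fst] measurable_compose[OF measurable_snd])
  from measurable_compose[OF this assms(1)] show ?thesis by simp
qed

lemma case_prod_measurable_continuous:
  fixes f :: "real \<Rightarrow> 'a \<Rightarrow> real"
  assumes "\<And>s. s \<in> {0..T} \<Longrightarrow> f s \<in> borel_measurable M"
    and "\<And>\<omega>. \<omega> \<in> space M \<Longrightarrow> continuous_on {0..T} (\<lambda>s. f s \<omega>)"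
  shows "case_prod f \<in> borel_measurable (Lt \<Otimes>\<^sub>M M)"
proof (rule case_prod_measurable_Lt)
  show "(\<lambda>(s, \<omega>). f s \<omega>) \<in> borel_measurable (restrict_space borel {0..T} \<Otimes>\<^sub>M M)"
    by (rule borel_measurable_pair_continuous) (use assms in auto)
qed (simp add: subalgebra_def)

lemma sq_Wc: "sq Wc"
  unfolding sq_def
proof
  show m[measurable]: "case_prod Wc \<in> borel_measurable (Lt \<Otimes>\<^sub>M M)"
    by (intro case_prod_measurable_continuous Wc_measurable continuous_Wc)
  show "integrable (Lt \<Otimes>\<^sub>M M) (\<lambda>(t, \<omega>). (Wc t \<omega>)\<^sup>2)"
  proof (rule Fubini_integrable)
    have "integrable Lt (\<lambda>t. t)" by (intro bdd_integrable bdd_continuous continuous_intros)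
    then show "integrable Lt (\<lambda>t. \<integral>\<omega>. norm (case (t, \<omega>) of (t, \<omega>) \<Rightarrow> (Wc t \<omega>)\<^sup>2) \<partial>M)"
      by (rule Bochner_Integration.integrable_cong[THEN iffD1, rotated 2]) (auto simp: Wc_moments)
    show "AE t in Lt. integrable M (\<lambda>\<omega>. case (t, \<omega>) of (t, \<omega>) \<Rightarrow> (Wc t \<omega>)\<^sup>2)"
      by (intro AE_I2) (auto simp: Wc_moments)
  qed measurable
qed

lemma expectation_increment:
  assumes s: "s \<in> {0..T}" and t: "t \<in> {0..T}" and "s \<le> t"
    and h: "h \<in> borel_measurable (F s)" "integrable M h"
  shows "expectation (\<lambda>\<omega>. h \<omega> * (Wc t \<omega> - Wc s \<omega>)) = 0"
proof (cases "s = t")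
  case False
  with \<open>s \<le> t\<close> t have t': "t \<in> {s<..T}" by auto
  note inc = brownian_increment[OF s t']
  have "expectation (\<lambda>\<omega>. h \<omega> * (Wc t \<omega> - Wc s \<omega>)) = expectation (\<lambda>\<omega>. h \<omega> * (W t \<omega> - W s \<omega>))"
    by (rule integral_cong_AE_complete, use AE_Wc in eventually_elim) simp
  also have "\<dots> = expectation h * expectation (\<lambda>\<omega>. W t \<omega> - W s \<omega>)"
    by (rule indep_set_expectation_mult[OF inc(5) space_F[OF s] _ h(1) _ h(2) inc(1)])
       (auto intro!: measurable_vimage_algebra1)
  finally show ?thesis using inc(2) by simp
qed simp

text \<open>Exchanging an event for the almost equal one from \<open>CG_noise\<close> changes
  neither its probability nor that of its intersection with \<open>a\<close>.\<close>

lemma indep_set_completed_noise: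
  assumes A: "indep_set A noise_sets"
  shows "indep_set A (sets (Gm T))"
proof (rule indep_setI)
  show "A \<subseteq> events" using A by (rule indep_setD_ev1)
  show "sets (Gm T) \<subseteq> events" using CG_subset_M[OF T_in] by (simp add: sets_Gm)
  fix a b assume a: "a \<in> A" and b: "b \<in> sets (Gm T)"
  then obtain b' where b': "b' \<in> noise_sets" and eq: "AE \<omega> in M. \<omega> \<in> b \<longleftrightarrow> \<omega> \<in> b'" and "b \<in> events"
    using CG_noise[OF T_in] by (auto simp: sets_Gm)
  have ev: "a \<in> events" "b' \<in> events" using a b' \<open>A \<subseteq> events\<close> noise_sets_subset by auto
  have "prob (a \<inter> b) = prob (a \<inter> b')"
    using ev \<open>b \<in> events\<close> eq by (intro finite_measure_eq_AE) auto
  moreover have "prob b = prob b'"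
    using ev \<open>b \<in> events\<close> eq by (intro finite_measure_eq_AE) auto
  ultimately show "prob (a \<inter> b) = prob a * prob b"
    using indep_setD[OF A a b'] by simp
qed

section \<open>Admissible controls as square integrable processes\<close>

lemma nn_integral_square_Lt:
  assumes [measurable]: "case_prod \<beta> \<in> borel_measurable (Lt \<Otimes>\<^sub>M M)"
  shows "(\<integral>\<^sup>+\<omega>. (\<integral>\<^sup>+t\<in>{0..T}. ennreal ((\<beta> t \<omega>)\<^sup>2) \<partial>lborel) \<partial>M) =
    (\<integral>\<^sup>+x. ennreal (norm (case x of (t, \<omega>) \<Rightarrow> (\<beta> t \<omega>)\<^sup>2)) \<partial>(Lt \<Otimes>\<^sub>M M))"
proof -
  have "(\<integral>\<^sup>+\<omega>. (\<integral>\<^sup>+t\<in>{0..T}. ennreal ((\<beta> t \<omega>)\<^sup>2) \<partial>lborel) \<partial>M) = (\<integral>\<^sup>+\<omega>. (\<integral>\<^sup>+t. ennreal ((\<beta> t \<omega>)\<^sup>2) \<partial>Lt) \<partial>M)"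
    unfolding Lt_def by (subst nn_integral_restrict_space) auto
  also have "\<dots> = (\<integral>\<^sup>+x. (case x of (t, \<omega>) \<Rightarrow> ennreal ((\<beta> t \<omega>)\<^sup>2)) \<partial>(Lt \<Otimes>\<^sub>M M))"
    by (subst nn_integral_snd[symmetric]) auto
  also have "\<dots> = (\<integral>\<^sup>+x. ennreal (norm (case x of (t, \<omega>) \<Rightarrow> (\<beta> t \<omega>)\<^sup>2)) \<partial>(Lt \<Otimes>\<^sub>M M))"
    by (intro nn_integral_cong) auto
  finally show ?thesis .
qed

text \<open>Progressive measurability at time \<open>T\<close> gives joint measurability, and its
  section at time \<open>t\<close> gives adaptedness. The filtration is arbitrary because both
  \<open>F\<close>, for \<open>\<alpha>\<close>, and \<open>GF\<close>, for \<open>\<beta>\<close>,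
  are needed.\<close>

lemma H2_progressive:
  assumes \<beta>: "\<beta> \<in> H2 M T \<G>" and G: "\<And>t. t \<in> {0..T} \<Longrightarrow> subalgebra M (\<G> t)"
  shows "sq \<beta>" "t \<in> {0..T} \<Longrightarrow> \<beta> t \<in> borel_measurable (\<G> t)"
proof -
  have prog: "\<And>t. t \<in> {0..T} \<Longrightarrow> (\<lambda>(s, \<omega>). \<beta> s \<omega>) \<in> borel_measurable (restrict_space borel {0..t} \<Otimes>\<^sub>M \<G> t)"
    and fin: "(\<integral>\<^sup>+\<omega>. (\<integral>\<^sup>+t\<in>{0..T}. ennreal ((\<beta> t \<omega>)\<^sup>2) \<partial>lborel) \<partial>M) < \<infinity>"
    using \<beta> by (auto simp: H2_def progressively_measurable_def)
  have m[measurable]: "case_prod \<beta> \<in> borel_measurable (Lt \<Otimes>\<^sub>M M)"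
    using prog[OF T_in] G[OF T_in] by (rule case_prod_measurable_Lt)
  have "integrable (Lt \<Otimes>\<^sub>M M) (\<lambda>(t, \<omega>). (\<beta> t \<omega>)\<^sup>2)"
    using fin unfolding nn_integral_square_Lt[OF m] by (intro integrableI_bounded) auto
  then show "sq \<beta>" using m by (simp add: sq_def)
  assume t: "t \<in> {0..T}"
  have "(\<lambda>\<omega>. (t, \<omega>)) \<in> measurable (\<G> t) (restrict_space borel {0..t} \<Otimes>\<^sub>M \<G> t)"
    using t by (intro measurable_Pair1') (auto simp: space_restrict_space)
  from measurable_compose[OF this prog[OF t]] show "\<beta> t \<in> borel_measurable (\<G> t)" by simp
qed

lemma H2_I:
  assumes "sq \<beta>" and "progressively_measurable T \<G> \<beta>"
  shows "\<beta> \<in> H2 M T \<G>"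
  using assms nn_integral_square_Lt[OF sq_measurable[OF assms(1)]]
    by (auto simp: H2_def sq_def integrable_iff_bounded)

end

section \<open>Payoffs of the flow and of its deviations\<close>

locale linear_flow = emission_game M T a b \<epsilon> F \<xi> W + riccati T \<epsilon> \<phi>
  for M :: "'a measure" and T a b \<epsilon> :: real and F :: "real \<Rightarrow> 'a measure"
    and \<xi> :: "'a \<Rightarrow> real" and W :: "real \<Rightarrow> 'a \<Rightarrow> real" and \<phi> :: "real \<Rightarrow> real" +
  fixes \<alpha> :: "real \<Rightarrow> 'a \<Rightarrow> real" and \<mu> :: "'a \<Rightarrow> real \<Rightarrow> real" and Z :: "'a \<Rightarrow> real"
  assumes class_Gl: "class_Gl M T F \<xi> W \<phi> \<alpha> \<mu> Z"
begin

abbreviation \<nu>\<^sub>1 :: real where "\<nu>\<^sub>1 \<equiv> expectation \<xi>"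
abbreviation z\<^sub>1 :: real where "z\<^sub>1 \<equiv> expectation Z"

text \<open>The Ornstein-Uhlenbeck process \<open>X\<^sup>\<alpha> - \<mu>\<close>, written as a pathwise functional of \<open>\<xi>\<close> and \<open>W\<close>; this
  makes it adapted to the filtration of the deviating player.\<close>
definition Y :: "real \<Rightarrow> 'a \<Rightarrow> real" where
  "Y t \<omega> = Wc t \<omega> + V (\<xi> \<omega> - \<nu>\<^sub>1) (\<lambda>s. Wc s \<omega>) t"

definition \<zeta> :: "'a \<Rightarrow> real" where "\<zeta> \<omega> = Z \<omega> - z\<^sub>1"

lemma flow: "correlated_flow M T F \<xi> W \<alpha> \<mu>"
  using class_Gl by (simp add: class_Gl_def)

lemma Z_square_integrable: "integrable M (\<lambda>\<omega>. (Z \<omega>)\<^sup>2)"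
  using class_Gl by (simp add: class_Gl_def)

lemma Z_measurable: "Z \<in> borel_measurable M"
  using class_Gl measurable_from_subalg[OF F_subalgebra[OF zero_in]] by (auto simp: class_Gl_def)

lemma Z_integrable: "integrable M Z"
  using Z_measurable Z_square_integrable by (rule square_integrable_imp_integrable)

lemma \<zeta>_measurable: "\<zeta> \<in> borel_measurable M"
  unfolding \<zeta>_def using Z_measurable by simp

lemma \<zeta>_integrable: "integrable M \<zeta>"
  unfolding \<zeta>_def using Z_integrable by simp

lemma \<zeta>_square_integrable: "integrable M (\<lambda>\<omega>. (\<zeta> \<omega>)\<^sup>2)"
  unfolding \<zeta>_def power2_diff using Z_square_integrable Z_integrable by simp

lemma expectation_\<zeta>: "expectation \<zeta> = 0"
  unfolding \<zeta>_def using Z_integrable by (simp add: prob_space)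

lemma sq_\<zeta>: "sq (\<lambda>t. \<zeta>)"
  using \<zeta>_measurable \<zeta>_square_integrable by (rule sq_const_time)

lemma continuous_Y: "continuous_on {0..T} (\<lambda>t. Y t \<omega>)"
  unfolding Y_def by (intro continuous_intros continuous_V continuous_Wc)

lemma Y_eq:
  assumes t: "t \<in> {0..T}"
  shows "Y t \<omega> = Wc t \<omega> + exp (- \<Phi> t) * (\<xi> \<omega> - \<nu>\<^sub>1 -
    (\<integral>s. ((if s \<le> t then 1 else 0) * (exp (\<Phi> s) * \<phi> s)) * Wc s \<omega> \<partial>Lt))"
  unfolding Y_def V_def LBINT_0_t[OF t] by (simp add: mult.assoc)

lemma Y_measurable_Gm:
  assumes t: "t \<in> {0..T}"
  shows "Y t \<in> borel_measurable (Gm t)"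
proof -
  have [measurable]: "Wc t \<in> borel_measurable (Gm t)" "\<xi> \<in> borel_measurable (Gm t)"
    using t by (auto intro: Wc_measurable_Gm \<xi>_measurable_Gm)
  have [measurable]: "(\<lambda>\<omega>. LBINT s:{0..t}. exp (\<Phi> s) * \<phi> s * Wc s \<omega>) \<in> borel_measurable (Gm t)"
  proof (rule measurable_LBINT_continuous)
    fix s assume "s \<in> {0..t}"
    then have [measurable]: "Wc s \<in> borel_measurable (Gm t)" by (rule Wc_measurable_Gm)
    show "(\<lambda>\<omega>. exp (\<Phi> s) * \<phi> s * Wc s \<omega>) \<in> borel_measurable (Gm t)" by measurable
  next
    fix \<omega>
    have "continuous_on {0..T} (\<lambda>s. exp (\<Phi> s) * \<phi> s * Wc s \<omega>)"
      by (intro continuous_intros continuous_\<Phi> continuous_\<phi> continuous_Wc)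
    then show "continuous_on {0..t} (\<lambda>s. exp (\<Phi> s) * \<phi> s * Wc s \<omega>)"
      by (rule continuous_on_subset) (use t in auto)
  qed
  show ?thesis unfolding Y_def V_def by measurable
qed

lemma subalgebra_Gm_mono: "s \<le> t \<Longrightarrow> subalgebra (Gm t) (Gm s)"
  using CG_mono[of s t] by (simp add: subalgebra_def sets_Gm)

lemma Y_measurable_Gm_T: "t \<in> {0..T} \<Longrightarrow> Y t \<in> borel_measurable (Gm T)"
  using measurable_from_subalg[OF subalgebra_Gm_mono Y_measurable_Gm, of t T] by simp

lemma Y_measurable: "t \<in> {0..T} \<Longrightarrow> Y t \<in> borel_measurable M"
  using Y_measurable_Gm_T measurable_Gm_M by blast

lemma bdd_kernel_\<Phi>: "bdd (\<lambda>s. (if s \<le> t then 1 else 0) * (exp (\<Phi> s) * \<phi> s)) Lt"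
  by (intro bdd_mult bdd_indicator_le bdd_continuous continuous_intros continuous_\<Phi> continuous_\<phi>)

lemma sq_Y: "sq Y"
proof -
  have "sq (\<lambda>t. \<xi>)" "sq (\<lambda>t \<omega>. \<nu>\<^sub>1)"
    using sq_const_time[OF \<xi>_measurable_M \<xi>_square_integrable] sq_const_time[of "\<lambda>_. \<nu>\<^sub>1"] by simp_all
  moreover have "bdd (\<lambda>s. exp (\<Phi> s) * \<phi> s) Lt" "bdd (\<lambda>t. exp (- \<Phi> t)) Lt"
    by (intro bdd_continuous continuous_intros continuous_\<Phi> continuous_\<phi>)+
  ultimately have "sq (\<lambda>t \<omega>. Wc t \<omega> + exp (- \<Phi> t) * (\<xi> \<omega> - \<nu>\<^sub>1 -
    (\<integral>s. (if s \<le> t then 1 else 0) * ((exp (\<Phi> s) * \<phi> s) * Wc s \<omega>) \<partial>Lt)))"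
    by (intro sq_add sq_Wc sq_mult_bdd sq_diff sq_LBINT)
  then show ?thesis
    by (subst sq_cong[OF Y_eq]) (simp_all add: mult.assoc)
qed

lemma Y_moments:
  assumes t: "t \<in> {0..T}"
  shows "integrable M (Y t)" "expectation (Y t) = 0"
proof -
  let ?I = "\<lambda>\<omega>. \<integral>s. ((if s \<le> t then 1 else 0) * (exp (\<Phi> s) * \<phi> s)) * Wc s \<omega> \<partial>Lt"
  have I: "integrable M ?I"
    using sq_time_integral[OF bdd_kernel_\<Phi> sq_Wc, of t] by (rule square_integrable_imp_integrable)
  have "(\<integral>\<omega>. 1 * ?I \<omega> \<partial>M) = 0"
    by (rule expectation_kernel_orthogonal[OF bdd_kernel_\<Phi> sq_Wc]) (auto simp: Wc_moments(2))
  then have I0: "expectation ?I = 0" by simp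
  show "integrable M (Y t)" "expectation (Y t) = 0"
    unfolding Y_eq[OF t] using I I0 Wc_moments[OF t] \<xi>_integrable
    by (simp_all add: prob_space)
qed

text \<open>The integral form of \<open>dY = - \<phi> Y dt + dW\<close>; it removes the feedback
  part of a deviation in \<open>deviation_path\<close>.\<close>

lemma Y_path:
  assumes t: "t \<in> {0..T}"
  shows "Y t \<omega> = Wc t \<omega> + \<xi> \<omega> - \<nu>\<^sub>1 - (LBINT s:{0..t}. \<phi> s * Y s \<omega>)"
proof -
  let ?V = "V (\<xi> \<omega> - \<nu>\<^sub>1) (\<lambda>s. Wc s \<omega>)"
  have "(LBINT s:{0..t}. \<phi> s * Y s \<omega>) = - ?V t - (- ?V 0)"
  proof (rule LBINT_Icc_FTC)
    fix x assume x: "x \<in> {0..t}"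
    have "(?V has_real_derivative - \<phi> x * (?V x + Wc x \<omega>)) (at x within {0..t})"
      by (rule DERIV_subset[OF DERIV_V[OF continuous_Wc]]) (use x t in auto)
    then show "((\<lambda>t. - ?V t) has_real_derivative \<phi> x * Y x \<omega>) (at x within {0..t})"
      unfolding Y_def by (auto intro!: derivative_eq_intros)
  next
    show "continuous_on {0..t} (\<lambda>s. \<phi> s * Y s \<omega>)"
      using t by (intro continuous_intros continuous_on_subset[OF continuous_\<phi>] continuous_on_subset[OF continuous_Y]) auto
  qed (use t in auto)
  then show ?thesis by (simp add: Y_def V_0)
qed

lemma sq_\<alpha>: "sq \<alpha>"
  using H2_progressive(1)[OF _ F_subalgebra] flow by (auto simp: correlated_flow_def)

text \<open>The implicit feedback equation is solved path by path through
  \<open>U = X - \<mu> - W\<close>. At first \<open>\<alpha>\<close> is merely integrable, so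
  \<open>U\<close> is continuous; the feedback formula then makes \<open>\<alpha>\<close>
  continuous, hence \<open>U\<close> is differentiable and \<open>V_unique\<close> identifies
  it.\<close>

lemma flow_path:
  "AE \<omega> in M. \<forall>t\<in>{0..T}. \<mu> \<omega> t = \<nu>\<^sub>1 + t * Z \<omega> \<and> state \<xi> W \<alpha> t \<omega> - \<mu> \<omega> t = Y t \<omega> \<and>
    \<alpha> t \<omega> = Z \<omega> - \<phi> t * Y t \<omega>"
proof -
  have "AE \<omega> in M. \<forall>t\<in>{0..T}. \<mu> \<omega> t = \<nu>\<^sub>1 + t * Z \<omega> \<and> \<alpha> t \<omega> = \<phi> t * (\<mu> \<omega> t - state \<xi> W \<alpha> t \<omega>) + Z \<omega>"
    using class_Gl by (simp add: class_Gl_def)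
  with AE_Wc sq_AE_path[OF sq_\<alpha>] show ?thesis
  proof eventually_elim
    case (elim \<omega>)
    define U where "U t = \<xi> \<omega> - \<nu>\<^sub>1 + (LBINT s:{0..t}. \<alpha> s \<omega>) - t * Z \<omega>" for t
    let ?w = "\<lambda>t. Wc t \<omega>"
    have st: "state \<xi> W \<alpha> t \<omega> - \<mu> \<omega> t = U t + ?w t" if "t \<in> {0..T}" for t
      using elim that unfolding state_def U_def by auto
    have \<alpha>: "\<alpha> t \<omega> = Z \<omega> - \<phi> t * (U t + ?w t)" if "t \<in> {0..T}" for t
    proof -
      have "\<mu> \<omega> t - state \<xi> W \<alpha> t \<omega> = - (U t + ?w t)" using st[OF that] by linarith
      moreover have "\<alpha> t \<omega> = \<phi> t * (\<mu> \<omega> t - state \<xi> W \<alpha> t \<omega>) + Z \<omega>" using elim(3) that by blast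
      ultimately have "\<alpha> t \<omega> = \<phi> t * (- (U t + ?w t)) + Z \<omega>" by (simp only:)
      then show ?thesis unfolding mult_minus_right by linarith
    qed
    have "set_integrable lborel {0..T} (\<lambda>t. \<alpha> t \<omega>)"
      using elim(2) unfolding Lt_def set_integrable_def by (subst (asm) integrable_restrict_space) auto
    then have U_cont: "continuous_on {0..T} U"
      unfolding U_def by (intro continuous_intros continuous_on_LBINT_Icc)
    have "continuous_on {0..T} (\<lambda>t. Z \<omega> - \<phi> t * (U t + ?w t))"
      by (intro continuous_intros continuous_\<phi> U_cont continuous_Wc)
    then have \<alpha>_cont: "continuous_on {0..T} (\<lambda>t. \<alpha> t \<omega>)"
      by (rule continuous_on_cong[THEN iffD1, rotated 2]) (simp_all add: \<alpha>)
    have D: "(U has_real_derivative - \<phi> t * (U t + ?w t)) (at t within {0..T})" if t: "t \<in> {0..T}" for t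
      unfolding U_def
      by (rule derivative_eq_intros LBINT_Icc_has_derivative[OF \<alpha>_cont t] refl)+ (simp add: \<alpha>[OF t] U_def)
    have U0: "U 0 = \<xi> \<omega> - \<nu>\<^sub>1"
      unfolding U_def by (simp add: LBINT_singleton)
    have "U t + ?w t = Y t \<omega>" if "t \<in> {0..T}" for t
      using V_unique[OF continuous_Wc D that] by (simp add: Y_def U0)
    with st \<alpha> elim(3) show ?case by auto
  qed
qed

section \<open>Independence and the consistency condition\<close>

lemma expectation_mult_indep_noise:
  fixes f h :: "'a \<Rightarrow> real"
  assumes ind: "indep_set (sets A) noise_sets" and A: "space A = space M"
    and f: "f \<in> borel_measurable A" "integrable M f" and h: "h \<in> borel_measurable (Gm T)" "integrable M h"
  shows "integrable M (\<lambda>\<omega>. f \<omega> * h \<omega>)" "expectation (\<lambda>\<omega>. f \<omega> * h \<omega>) = expectation f * expectation h"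
  using indep_set_expectation_mult[OF indep_set_completed_noise[OF ind] A space_Gm f(1) h(1) f(2) h(2)] by auto

lemma expectation_\<zeta>_mult:
  assumes h: "h \<in> borel_measurable (Gm T)" "integrable M h"
  shows "expectation (\<lambda>\<omega>. \<zeta> \<omega> * h \<omega>) = 0"
proof -
  let ?A = "vimage_algebra (space M) Z borel"
  have "indep_set (sets ?A) noise_sets"
    using class_Gl by (simp add: class_Gl_def indep_rvs_def)
  moreover have "\<zeta> \<in> borel_measurable ?A"
    unfolding \<zeta>_def by (intro borel_measurable_diff measurable_vimage_algebra1) auto
  ultimately show ?thesis
    using expectation_mult_indep_noise(2)[OF _ _ _ \<zeta>_integrable h, of ?A] expectation_\<zeta> by simp
qed

text \<open>A test event \<open>B\<close> lies in the sigma-algebra generated by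
  \<open>\<mu>\<close>, which is independent of the noise, so the integral of \<open>Y t\<close>
  over \<open>B\<close> is the product of the probability of \<open>B\<close> and the mean 0 of
  \<open>Y t\<close>.\<close>

lemma conditional_expectation_state:
  assumes t: "t \<in> {0..T}"
  shows "AE \<omega> in M. \<mu> \<omega> t = real_cond_exp M (vimage_algebra (space M) \<mu> (path_borel T)) (state \<xi> W \<alpha> t) \<omega>"
proof -
  let ?A = "vimage_algebra (space M) \<mu> (path_borel T)"
  have \<mu>[measurable]: "\<mu> \<in> measurable M (path_borel T)" and ind: "indep_set (sets ?A) noise_sets"
    using flow by (auto simp: correlated_flow_def indep_rvs_def)
  have \<mu>_fun: "\<mu> \<in> space M \<rightarrow> space (path_borel T)" using measurable_space[OF \<mu>] by auto
  have sub: "subalgebra M ?A"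
    using measurable_sets[OF \<mu>] by (auto simp: subalgebra_def sets_vimage_algebra2[OF \<mu>_fun])
  interpret A: finite_measure_subalgebra M ?A
    using sub by unfold_locales
  have \<mu>_A: "(\<lambda>\<omega>. \<mu> \<omega> t) \<in> borel_measurable ?A"
    using measurable_compose[OF measurable_vimage_algebra1[OF \<mu>_fun] measurable_eval_path_borel[OF t]] .
  then have \<mu>_M: "(\<lambda>\<omega>. \<mu> \<omega> t) \<in> borel_measurable M"
    by (rule measurable_from_subalg[OF sub])
  have 1: "AE \<omega> in M. \<mu> \<omega> t = \<nu>\<^sub>1 + t * Z \<omega>" and 2: "AE \<omega> in M. state \<xi> W \<alpha> t \<omega> = \<mu> \<omega> t + Y t \<omega>"
    by (rule eventually_mono[OF flow_path]; use t in force)+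
  have i1: "integrable M (\<lambda>\<omega>. \<mu> \<omega> t)"
    by (rule integrable_cong_AE[THEN iffD2, OF \<mu>_M _ 1]) (use Z_integrable Z_measurable in auto)
  \<comment> \<open>Integrals of control paths enter the state, so its measurability is obtained
    from the almost everywhere equal sum and completeness.\<close>
  have m2: "state \<xi> W \<alpha> t \<in> borel_measurable M"
    by (rule AE_cong_measurable[OF 2]) (use \<mu>_M Y_measurable[OF t] in measurable)
  have i2: "integrable M (state \<xi> W \<alpha> t)"
    by (rule integrable_cong_AE[THEN iffD2, OF m2 _ 2]) (use i1 Y_moments[OF t] in auto)
  have "AE \<omega> in M. real_cond_exp M ?A (state \<xi> W \<alpha> t) \<omega> = \<mu> \<omega> t"
  proof (rule A.real_cond_exp_charact[OF _ i2 i1 \<mu>_A])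
    fix B assume B: "B \<in> sets ?A"
    then have BM: "B \<in> sets M" using sub by (auto simp: subalgebra_def)
    have "(\<integral>\<omega>\<in>B. state \<xi> W \<alpha> t \<omega> \<partial>M) = (\<integral>\<omega>. indicator B \<omega> * \<mu> \<omega> t + indicator B \<omega> * Y t \<omega> \<partial>M)"
      unfolding set_lebesgue_integral_def
      by (rule integral_cong_AE_complete, use 2 in eventually_elim) (simp add: algebra_simps)
    also have "\<dots> = (\<integral>\<omega>\<in>B. \<mu> \<omega> t \<partial>M) + (\<integral>\<omega>. indicator B \<omega> * Y t \<omega> \<partial>M)"
      unfolding set_lebesgue_integral_def
      using integrable_mult_indicator[OF BM i1] integrable_mult_indicator[OF BM Y_moments(1)[OF t]] by simp
    also have "(\<integral>\<omega>. indicator B \<omega> * Y t \<omega> \<partial>M) = expectation (indicator B) * expectation (Y t)"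
      by (rule expectation_mult_indep_noise(2)[OF ind])
         (use B BM Y_moments[OF t] Y_measurable_Gm_T[OF t] in \<open>auto simp: emeasure_eq_measure\<close>)
    finally show "(\<integral>\<omega>\<in>B. state \<xi> W \<alpha> t \<omega> \<partial>M) = (\<integral>\<omega>\<in>B. \<mu> \<omega> t \<partial>M)"
      using Y_moments(2)[OF t] by simp
  qed
  then show ?thesis by eventually_elim simp
qed

section \<open>Payoffs as integrals over time and probability\<close>

abbreviation PI :: "(real \<Rightarrow> 'a \<Rightarrow> real) \<Rightarrow> real" where
  "PI f \<equiv> integral\<^sup>L (Lt \<Otimes>\<^sub>M M) (case_prod f)"

lemma sq_integrable_square: "sq f \<Longrightarrow> integrable (Lt \<Otimes>\<^sub>M M) (case_prod (\<lambda>t \<omega>. (f t \<omega>)\<^sup>2))"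
  by (simp add: sq_def)

lemma PI_add:
  "integrable (Lt \<Otimes>\<^sub>M M) (case_prod f) \<Longrightarrow> integrable (Lt \<Otimes>\<^sub>M M) (case_prod h) \<Longrightarrow>
    integrable (Lt \<Otimes>\<^sub>M M) (case_prod (\<lambda>t \<omega>. f t \<omega> + h t \<omega>)) \<and> PI (\<lambda>t \<omega>. f t \<omega> + h t \<omega>) = PI f + PI h"
  by (simp add: case_prod_beta')

lemma PI_cmult:
  "integrable (Lt \<Otimes>\<^sub>M M) (case_prod f) \<Longrightarrow>
    integrable (Lt \<Otimes>\<^sub>M M) (case_prod (\<lambda>t \<omega>. c * f t \<omega>)) \<and> PI (\<lambda>t \<omega>. c * f t \<omega>) = c * PI f"
  by (simp add: case_prod_beta')

lemma sq_\<mu>: "sq (\<lambda>t \<omega>. \<nu>\<^sub>1 + t * Z \<omega>)"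
  by (intro sq_add sq_deterministic sq_mult_bdd sq_const_time Z_measurable Z_square_integrable bdd_continuous continuous_intros)

text \<open>The terms with \<open>a\<close> and \<open>b\<close> depend on the flow alone and will
  cancel between \<open>\<alpha>\<close> and \<open>\<beta>\<close>. The processes
  \<open>\<gamma>\<close> and \<open>D\<close> stand for the control and the gap between state and
  flow, up to a null set of paths.\<close>

lemma payoff_eq:
  assumes sq: "sq \<gamma>" "sq D"
    and path: "AE \<omega> in M. \<forall>t\<in>{0..T}. \<mu> \<omega> t = \<nu>\<^sub>1 + t * Z \<omega> \<and> state \<xi> W \<beta> t \<omega> - \<mu> \<omega> t = D t \<omega> \<and> \<beta> t \<omega> = \<gamma> t \<omega>"
  shows "payoff M T a b \<epsilon> \<xi> W \<beta> \<mu> = PI (\<lambda>t \<omega>. a * (\<nu>\<^sub>1 + t * Z \<omega>) - b / 2 * (\<nu>\<^sub>1 + t * Z \<omega>)\<^sup>2)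
    - 1 / 2 * PI (\<lambda>t \<omega>. (\<gamma> t \<omega>)\<^sup>2 + \<epsilon> * (D t \<omega>)\<^sup>2)"
proof -
  let ?m = "\<lambda>t \<omega>. \<nu>\<^sub>1 + t * Z \<omega>"
  let ?A = "\<lambda>t \<omega>. a * ?m t \<omega> - b / 2 * (?m t \<omega>)\<^sup>2" and ?B = "\<lambda>t \<omega>. (\<gamma> t \<omega>)\<^sup>2 + \<epsilon> * (D t \<omega>)\<^sup>2"
  have "integrable (Lt \<Otimes>\<^sub>M M) (case_prod (\<lambda>t \<omega>. ?m t \<omega> * 1))"
    by (intro sq_integrable_mult sq_\<mu> sq_deterministic bdd_continuous continuous_intros)
  then have iA: "integrable (Lt \<Otimes>\<^sub>M M) (case_prod ?A)"
    using sq_integrable_square[OF sq_\<mu>] by (simp add: case_prod_beta')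
  have iB: "integrable (Lt \<Otimes>\<^sub>M M) (case_prod ?B)"
    using sq_integrable_square[OF sq(1)] sq_integrable_square[OF sq(2)] by (simp add: case_prod_beta')
  have "payoff M T a b \<epsilon> \<xi> W \<beta> \<mu> = (\<integral>\<omega>. (\<integral>t. ?A t \<omega> + (- 1 / 2) * ?B t \<omega> \<partial>Lt) \<partial>M)"
    unfolding payoff_def LBINT_0_T
  proof (rule integral_cong_AE_complete, use path in eventually_elim)
    case (elim \<omega>)
    show ?case
    proof (rule Bochner_Integration.integral_cong[OF refl])
      fix t assume "t \<in> space Lt"
      then have "t \<in> {0..T}" by simp
      with elim have "\<mu> \<omega> t = ?m t \<omega>" "\<beta> t \<omega> = \<gamma> t \<omega>" "state \<xi> W \<beta> t \<omega> - \<mu> \<omega> t = D t \<omega>" by blast+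
      moreover from this(3) have "(\<mu> \<omega> t - state \<xi> W \<beta> t \<omega>)\<^sup>2 = (D t \<omega>)\<^sup>2"
        using power2_commute by metis
      ultimately show "a * \<mu> \<omega> t - b / 2 * (\<mu> \<omega> t)\<^sup>2 - 1 / 2 * (\<beta> t \<omega>)\<^sup>2 - \<epsilon> / 2 * (\<mu> \<omega> t - state \<xi> W \<beta> t \<omega>)\<^sup>2
          = ?A t \<omega> + (- 1 / 2) * ?B t \<omega>" by (simp add: algebra_simps)
    qed
  qed
  also have "\<dots> = PI (\<lambda>t \<omega>. ?A t \<omega> + (- 1 / 2) * ?B t \<omega>)"
    by (rule integral_snd) (use PI_add[OF iA PI_cmult[OF iB, THEN conjunct1]] in blast)
  also have "\<dots> = PI ?A + PI (\<lambda>t \<omega>. (- 1 / 2) * ?B t \<omega>)"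
    by (rule PI_add[OF iA PI_cmult[OF iB, THEN conjunct1], THEN conjunct2])
  also have "PI (\<lambda>t \<omega>. (- 1 / 2) * ?B t \<omega>) = (- 1 / 2) * PI ?B"
    by (rule PI_cmult[OF iB, THEN conjunct2])
  finally show ?thesis by simp
qed

lemma sq_\<alpha>_reduced: "sq (\<lambda>t \<omega>. Z \<omega> - \<phi> t * Y t \<omega>)"
  by (intro sq_diff sq_const_time Z_measurable Z_square_integrable sq_mult_bdd bdd_continuous continuous_\<phi> sq_Y)

lemma payoff_\<alpha>:
  "payoff M T a b \<epsilon> \<xi> W \<alpha> \<mu> = PI (\<lambda>t \<omega>. a * (\<nu>\<^sub>1 + t * Z \<omega>) - b / 2 * (\<nu>\<^sub>1 + t * Z \<omega>)\<^sup>2)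
    - 1 / 2 * PI (\<lambda>t \<omega>. (Z \<omega> - \<phi> t * Y t \<omega>)\<^sup>2 + \<epsilon> * (Y t \<omega>)\<^sup>2)"
  using sq_\<alpha>_reduced sq_Y flow_path by (rule payoff_eq)

section \<open>Mixed terms that vanish by centring and independence\<close>

lemma PI_Y: "bdd c Lt \<Longrightarrow> PI (\<lambda>t \<omega>. c t * Y t \<omega>) = 0"
  by (rule integral_orthogonal[OF sq_deterministic sq_Y]) (auto simp: Y_moments)

lemma PI_\<zeta>: "bdd c Lt \<Longrightarrow> PI (\<lambda>t \<omega>. c t * \<zeta> \<omega>) = 0"
  by (rule integral_orthogonal[OF sq_deterministic sq_\<zeta>]) (auto simp: expectation_\<zeta>)

lemma PI_\<zeta>_Y:
  assumes "bdd c Lt"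
  shows "PI (\<lambda>t \<omega>. (c t * \<zeta> \<omega>) * Y t \<omega>) = 0"
proof (rule integral_orthogonal[OF sq_mult_bdd[OF assms sq_\<zeta>] sq_Y], rule AE_I2)
  fix t assume "t \<in> space Lt"
  then have "expectation (\<lambda>\<omega>. \<zeta> \<omega> * Y t \<omega>) = 0"
    using Y_measurable_Gm_T Y_moments by (intro expectation_\<zeta>_mult) auto
  then show "expectation (\<lambda>\<omega>. (c t * \<zeta> \<omega>) * Y t \<omega>) = 0" by (simp add: mult.assoc)
qed

end

text \<open>A deviation \<open>\<beta>\<close> is described by its distance \<open>\<eta>\<close> from the best response \<open>z\<^sub>1 p - \<phi> Y\<close>.\<close>

locale deviation = linear_flow +
  fixes \<beta> :: "real \<Rightarrow> 'a \<Rightarrow> real"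
  assumes \<beta>_H2: "\<beta> \<in> H2 M T GF"
begin

definition \<eta> :: "real \<Rightarrow> 'a \<Rightarrow> real" where
  "\<eta> t \<omega> = \<beta> t \<omega> + \<phi> t * Y t \<omega> - z\<^sub>1 * p t"

definition \<H> :: "real \<Rightarrow> 'a \<Rightarrow> real" where
  "\<H> t \<omega> = (\<integral>s. (if s \<le> t then 1 else 0) * \<eta> s \<omega> \<partial>Lt)"

definition D :: "real \<Rightarrow> 'a \<Rightarrow> real" where
  "D t \<omega> = Y t \<omega> + \<H> t \<omega> - z\<^sub>1 * r t - t * \<zeta> \<omega>"

lemma sq_\<beta>: "sq \<beta>"
  using H2_progressive(1)[OF \<beta>_H2] subalgebra_Gm_GF subalgebra_Gm[OF T_in]
  by (auto simp: subalgebra_def)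

lemma \<beta>_measurable_GF: "t \<in> {0..T} \<Longrightarrow> \<beta> t \<in> borel_measurable (GF t)"
  using H2_progressive(2)[OF \<beta>_H2] subalgebra_Gm_GF subalgebra_Gm[OF T_in]
  by (auto simp: subalgebra_def)

lemma sq_\<eta>: "sq \<eta>"
  unfolding \<eta>_def
  by (intro sq_diff sq_add sq_\<beta> sq_mult_bdd sq_Y sq_deterministic bdd_continuous continuous_intros continuous_\<phi> continuous_p)

lemma sq_\<H>: "sq \<H>"
  unfolding \<H>_def by (intro sq_LBINT sq_\<eta>)

lemma sq_D: "sq D"
  unfolding D_def
  by (intro sq_diff sq_add sq_Y sq_\<H> sq_mult_bdd sq_\<zeta> sq_deterministic bdd_continuous continuous_intros continuous_r)

text \<open>The first bound yields independence of \<open>\<zeta>\<close>, the second independence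
  of the Brownian increments after \<open>t\<close>.\<close>

lemma \<eta>_measurable:
  assumes t: "t \<in> {0..T}"
  shows "\<eta> t \<in> borel_measurable (Gm T)" "\<eta> t \<in> borel_measurable (F t)"
proof -
  have [measurable]: "\<beta> t \<in> borel_measurable (Gm T)" "Y t \<in> borel_measurable (Gm T)"
    using measurable_from_subalg[OF subalgebra_Gm_GF[OF t] \<beta>_measurable_GF[OF t]] Y_measurable_Gm_T[OF t] by auto
  show "\<eta> t \<in> borel_measurable (Gm T)" unfolding \<eta>_def by measurable
  have [measurable]: "\<beta> t \<in> borel_measurable (F t)" "Y t \<in> borel_measurable (F t)"
    using measurable_from_subalg[OF subalgebra_F_GF[OF t] \<beta>_measurable_GF[OF t]]
      measurable_from_subalg[OF subalgebra_F_Gm[OF t] Y_measurable_Gm[OF t]] by auto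
  show "\<eta> t \<in> borel_measurable (F t)" unfolding \<eta>_def by measurable
qed

lemma AE_\<eta>_integrable: "AE t in Lt. integrable M (\<eta> t)"
  using sq_AE_time[OF sq_\<eta>] by eventually_elim (auto intro: square_integrable_imp_integrable)

text \<open>In \<open>\<beta> = \<eta> - \<phi> Y + z\<^sub>1 p\<close> the parts integrate to
  \<open>\<H>\<close>, to the drift of \<open>Y\<close>, and to
  \<open>z\<^sub>1 * (t - r t)\<close>; subtracting \<open>t * Z\<close> leaves the errors
  \<open>z\<^sub>1 * r t\<close> and \<open>t * \<zeta>\<close>. The trivial last conjunct fits the
  shape of \<open>payoff_eq\<close>.\<close>

lemma deviation_path:
  "AE \<omega> in M. \<forall>t\<in>{0..T}. \<mu> \<omega> t = \<nu>\<^sub>1 + t * Z \<omega> \<and> state \<xi> W \<beta> t \<omega> - \<mu> \<omega> t = D t \<omega> \<and> \<beta> t \<omega> = \<beta> t \<omega>"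
  using flow_path AE_Wc sq_AE_path[OF sq_\<eta>]
proof eventually_elim
  case (elim \<omega>)
  show ?case
  proof (intro ballI conjI refl)
    fix t assume t: "t \<in> {0..T}"
    show \<mu>: "\<mu> \<omega> t = \<nu>\<^sub>1 + t * Z \<omega>" using elim t by blast
    let ?k = "\<lambda>s. if s \<le> t then 1 else 0 :: real"
    have i1: "integrable Lt (\<lambda>s. ?k s * \<eta> s \<omega>)"
      using elim(3) by (auto intro!: Bochner_Integration.integrable_bound[of Lt "\<lambda>s. \<eta> s \<omega>"])
    have i2: "integrable Lt (\<lambda>s. ?k s * (\<phi> s * Y s \<omega>))"
      by (intro bdd_integrable bdd_mult bdd_indicator_le bdd_continuous continuous_\<phi> continuous_Y)
    have i3: "integrable Lt (\<lambda>s. ?k s * p s)"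
      by (intro bdd_integrable bdd_mult bdd_indicator_le bdd_continuous continuous_p)
    have "(LBINT s:{0..t}. \<beta> s \<omega>) = (\<integral>s. ?k s * \<eta> s \<omega> - ?k s * (\<phi> s * Y s \<omega>) + z\<^sub>1 * (?k s * p s) \<partial>Lt)"
      unfolding LBINT_0_t[OF t] by (rule Bochner_Integration.integral_cong) (auto simp: \<eta>_def)
    also have "\<dots> = \<H> t \<omega> - (LBINT s:{0..t}. \<phi> s * Y s \<omega>) + z\<^sub>1 * (LBINT s:{0..t}. p s)"
      using i1 i2 i3 unfolding \<H>_def LBINT_0_t[OF t] by simp
    also have "\<dots> = \<H> t \<omega> - (LBINT s:{0..t}. \<phi> s * Y s \<omega>) + z\<^sub>1 * (t - r t)"
      unfolding LBINT_p[OF t] ..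
    finally show "state \<xi> W \<beta> t \<omega> - \<mu> \<omega> t = D t \<omega>"
      using Y_path[OF t, of \<omega>] elim(2) unfolding state_def \<mu> D_def \<zeta>_def by (simp add: algebra_simps)
  qed
qed

lemma payoff_\<beta>:
  "payoff M T a b \<epsilon> \<xi> W \<beta> \<mu> = PI (\<lambda>t \<omega>. a * (\<nu>\<^sub>1 + t * Z \<omega>) - b / 2 * (\<nu>\<^sub>1 + t * Z \<omega>)\<^sup>2)
    - 1 / 2 * PI (\<lambda>t \<omega>. (\<beta> t \<omega>)\<^sup>2 + \<epsilon> * (D t \<omega>)\<^sup>2)"
  using sq_\<beta> sq_D deviation_path by (rule payoff_eq)

text \<open>The deviating player cannot see \<open>Z\<close>: each \<open>\<eta> s\<close> is a
  functional of the completed noise and hence uncorrelated with \<open>\<zeta>\<close>, and Fubini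
  carries this over to \<open>\<H>\<close>.\<close>

lemma PI_\<zeta>_\<H>: "PI (\<lambda>t \<omega>. (t * \<zeta> \<omega>) * \<H> t \<omega>) = 0"
proof (rule integral_orthogonal[OF _ sq_\<H>])
  show "sq (\<lambda>t \<omega>. t * \<zeta> \<omega>)"
    by (intro sq_mult_bdd sq_\<zeta> bdd_continuous continuous_intros)
  have 0: "AE s in Lt. expectation (\<lambda>\<omega>. \<zeta> \<omega> * \<eta> s \<omega>) = 0"
  proof -
    have "AE s in Lt. s \<in> {0..T}" using AE_space[of Lt] by simp
    with AE_\<eta>_integrable show ?thesis
      by eventually_elim (rule expectation_\<zeta>_mult[OF \<eta>_measurable(1)])
  qed
  have "expectation (\<lambda>\<omega>. \<zeta> \<omega> * \<H> t \<omega>) = 0" for t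
    unfolding \<H>_def
    by (rule expectation_kernel_orthogonal[OF bdd_indicator_le sq_\<eta> \<zeta>_measurable \<zeta>_square_integrable 0])
  then show "AE t in Lt. expectation (\<lambda>\<omega>. (t * \<zeta> \<omega>) * \<H> t \<omega>) = 0"
    by (simp add: mult.assoc)
qed

text \<open>First-order condition for the deterministic control problem, pathwise.\<close>
lemma PI_\<eta>_p: "PI (\<lambda>t \<omega>. \<eta> t \<omega> * p t - (\<epsilon> * r t) * \<H> t \<omega>) = 0"
proof -
  have b: "bdd p Lt" "bdd (\<lambda>t. \<epsilon> * r t) Lt"
    by (intro bdd_continuous continuous_intros continuous_p continuous_r)+
  have i: "integrable (Lt \<Otimes>\<^sub>M M) (case_prod (\<lambda>t \<omega>. \<eta> t \<omega> * p t - (\<epsilon> * r t) * \<H> t \<omega>))"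
    using sq_integrable_mult[OF sq_\<eta> sq_deterministic[OF b(1)]] sq_integrable_mult[OF sq_deterministic[OF b(2)] sq_\<H>]
    by (simp add: case_prod_beta')
  have "AE \<omega> in M. (\<integral>t. \<eta> t \<omega> * p t - (\<epsilon> * r t) * \<H> t \<omega> \<partial>Lt) = 0"
    using sq_AE_path[OF sq_\<eta>] AE_integrable_snd[OF sq_integrable_mult[OF sq_\<eta> sq_deterministic[OF b(1)]]]
      AE_integrable_snd[OF sq_integrable_mult[OF sq_deterministic[OF b(2)] sq_\<H>]]
  proof eventually_elim
    case (elim \<omega>)
    \<comment> \<open>Exchanging the time integrals leaves the tail integral of
      \<open>\<epsilon> * r\<close> against \<open>\<eta> s\<close>, which is
      \<open>p s\<close>.\<close>
    have "(\<integral>t. (\<epsilon> * r t) * \<H> t \<omega> \<partial>Lt) = (\<integral>s. \<eta> s \<omega> * (\<integral>t. (if s \<le> t then 1 else 0) * (\<epsilon> * r t) \<partial>Lt) \<partial>Lt)"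
      unfolding \<H>_def using elim(1) by (intro integral_kernel_swap[OF bdd_kernel] bdd_integrable[OF b(2)]) auto
    also have "\<dots> = (\<integral>s. \<eta> s \<omega> * p s \<partial>Lt)"
      by (rule Bochner_Integration.integral_cong) (auto simp: trans[OF LBINT_t_T[symmetric] LBINT_\<epsilon>_r])
    finally show ?case using elim(2,3) by simp
  qed
  then show ?thesis
    unfolding integral_snd[OF i, symmetric] by (rule integral_eq_zero_AE)
qed

text \<open>The Brownian increments after time \<open>s\<close> are orthogonal to \<open>\<eta>\<^sub>s\<close>; this replaces the
  martingale property of a stochastic integral.\<close>
lemma PI_\<eta>_Y: "PI (\<lambda>t \<omega>. (\<epsilon> * Y t \<omega>) * \<H> t \<omega> - \<eta> t \<omega> * (\<phi> t * Y t \<omega>)) = 0"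
proof -
  \<comment> \<open>What multiplies \<open>\<eta> s\<close> once the time integrals are exchanged.
    In Ito terms it is the stochastic integral of \<open>\<phi>\<close> from \<open>s\<close> to
    \<open>T\<close>; \<open>S_eq\<close> expresses it by increments after \<open>s\<close>.\<close>
  define S where "S s \<omega> = (\<integral>t. (if s \<le> t then 1 else 0) * (\<epsilon> * Y t \<omega>) \<partial>Lt) - \<phi> s * Y s \<omega>" for s \<omega>
  have sqs: "sq (\<lambda>t \<omega>. \<epsilon> * Y t \<omega>)" "sq (\<lambda>t \<omega>. \<phi> t * Y t \<omega>)"
    by (intro sq_mult_bdd sq_Y bdd_continuous continuous_intros continuous_\<phi>)+
  have "bdd (\<lambda>(s, t). if s \<le> t then 1 else 0) (Lt \<Otimes>\<^sub>M Lt)"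
    unfolding bdd_def by (intro conjI exI[of _ 1]) (auto simp: case_prod_beta')
  then have sq_S: "sq S" unfolding S_def
    by (intro sq_diff sqs sq_kernel)
  \<comment> \<open>The kernel already vanishes for \<open>t < s\<close>. The increment is truncated
    as well, because the orthogonality lemma asks about almost every \<open>t\<close> in
    \<open>{0..T}\<close>, while earlier increments may be correlated with
    \<open>\<eta> s\<close>.\<close>
  have S_eq: "S s \<omega> = - (\<integral>t. (if s \<le> t then 1 else 0) * ((\<phi> t)\<^sup>2 - \<epsilon>) * (if s \<le> t then Wc t \<omega> - Wc s \<omega> else 0) \<partial>Lt)"
    if s: "s \<in> {0..T}" for s \<omega>
  proof -
    have "S s \<omega> = - (LBINT t:{s..T}. ((\<phi> t)\<^sup>2 - \<epsilon>) * (Wc t \<omega> - Wc s \<omega>))"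
      using adjoint_identity[OF continuous_Wc s, of \<omega> "\<xi> \<omega> - \<nu>\<^sub>1"]
      unfolding S_def LBINT_t_T[OF s, symmetric] Y_def by simp
    also have "\<dots> = - (\<integral>t. (if s \<le> t then 1 else 0) * ((\<phi> t)\<^sup>2 - \<epsilon>) * (if s \<le> t then Wc t \<omega> - Wc s \<omega> else 0) \<partial>Lt)"
      unfolding LBINT_t_T[OF s] by (intro arg_cong[of _ _ uminus] Bochner_Integration.integral_cong) auto
    finally show ?thesis .
  qed
  have orth: "AE s in Lt. expectation (\<lambda>\<omega>. \<eta> s \<omega> * S s \<omega>) = 0"
  proof -
    have "AE s in Lt. s \<in> {0..T}" using AE_space[of Lt] by simp
    with AE_\<eta>_integrable sq_AE_time[OF sq_\<eta>] show ?thesis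
    proof eventually_elim
      case (elim s)
      have bk: "bdd (\<lambda>t. if s \<le> t then 1 else 0) Lt"
        unfolding bdd_def by (intro conjI exI[of _ 1]) auto
      have "expectation (\<lambda>\<omega>. \<eta> s \<omega> * (\<integral>t. (if s \<le> t then 1 else 0) * ((\<phi> t)\<^sup>2 - \<epsilon>) * (if s \<le> t then Wc t \<omega> - Wc s \<omega> else 0) \<partial>Lt)) = 0"
      proof (rule expectation_kernel_orthogonal)
        show "bdd (\<lambda>t. (if s \<le> t then 1 else 0) * ((\<phi> t)\<^sup>2 - \<epsilon>)) Lt"
          by (intro bdd_mult bk bdd_continuous continuous_intros continuous_\<phi>)
        have "sq (\<lambda>t \<omega>. (if s \<le> t then 1 else 0) * (Wc t \<omega> - Wc s \<omega>))"
          using elim Wc_measurable[of s] Wc_moments[of s]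
          by (intro sq_mult_bdd bk sq_diff sq_Wc sq_const_time) auto
        then show "sq (\<lambda>t \<omega>. if s \<le> t then Wc t \<omega> - Wc s \<omega> else 0)"
          by (rule sq_cong[THEN iffD1, rotated]) auto
        show "\<eta> s \<in> borel_measurable M" "integrable M (\<lambda>\<omega>. (\<eta> s \<omega>)\<^sup>2)" using elim by auto
        show "AE t in Lt. expectation (\<lambda>\<omega>. \<eta> s \<omega> * (if s \<le> t then Wc t \<omega> - Wc s \<omega> else 0)) = 0"
        proof (rule AE_I2)
          fix t assume "t \<in> space Lt"
          then show "expectation (\<lambda>\<omega>. \<eta> s \<omega> * (if s \<le> t then Wc t \<omega> - Wc s \<omega> else 0)) = 0"
            using expectation_increment[of s t "\<eta> s"] \<eta>_measurable(2)[of s] elim by (cases "s \<le> t") auto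
        qed
      qed
      then show ?case using elim(3) by (simp add: S_eq)
    qed
  qed
  have i: "integrable (Lt \<Otimes>\<^sub>M M) (case_prod (\<lambda>t \<omega>. (\<epsilon> * Y t \<omega>) * \<H> t \<omega> - \<eta> t \<omega> * (\<phi> t * Y t \<omega>)))"
    using sq_integrable_mult[OF sqs(1) sq_\<H>] sq_integrable_mult[OF sq_\<eta> sqs(2)] by (simp add: case_prod_beta')
  have "PI (\<lambda>t \<omega>. (\<epsilon> * Y t \<omega>) * \<H> t \<omega> - \<eta> t \<omega> * (\<phi> t * Y t \<omega>)) =
      (\<integral>\<omega>. (\<integral>t. (\<epsilon> * Y t \<omega>) * \<H> t \<omega> - \<eta> t \<omega> * (\<phi> t * Y t \<omega>) \<partial>Lt) \<partial>M)"
    using integral_snd[OF i] by simp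
  also have "\<dots> = (\<integral>\<omega>. (\<integral>s. \<eta> s \<omega> * S s \<omega> \<partial>Lt) \<partial>M)"
  proof (rule integral_cong_AE_complete)
    show "AE \<omega> in M. (\<integral>t. (\<epsilon> * Y t \<omega>) * \<H> t \<omega> - \<eta> t \<omega> * (\<phi> t * Y t \<omega>) \<partial>Lt) = (\<integral>s. \<eta> s \<omega> * S s \<omega> \<partial>Lt)"
      using sq_AE_path[OF sq_\<eta>] AE_integrable_snd[OF sq_integrable_mult[OF sqs(1) sq_\<H>]]
        AE_integrable_snd[OF sq_integrable_mult[OF sq_\<eta> sqs(2)]] AE_integrable_snd[OF sq_integrable_mult[OF sq_\<eta> sq_S]]
        sq_AE_path[OF sqs(1)]
    proof eventually_elim
      case (elim \<omega>)
      have "(\<integral>t. (\<epsilon> * Y t \<omega>) * \<H> t \<omega> \<partial>Lt) = (\<integral>s. \<eta> s \<omega> * (\<integral>t. (if s \<le> t then 1 else 0) * (\<epsilon> * Y t \<omega>) \<partial>Lt) \<partial>Lt)"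
        unfolding \<H>_def using elim(1,5) by (intro integral_kernel_swap[OF bdd_kernel]) auto
      also have "\<dots> = (\<integral>s. \<eta> s \<omega> * S s \<omega> + \<eta> s \<omega> * (\<phi> s * Y s \<omega>) \<partial>Lt)"
        by (rule Bochner_Integration.integral_cong) (auto simp: S_def algebra_simps)
      also have "\<dots> = (\<integral>s. \<eta> s \<omega> * S s \<omega> \<partial>Lt) + (\<integral>s. \<eta> s \<omega> * (\<phi> s * Y s \<omega>) \<partial>Lt)"
        using elim(3,4) by simp
      finally show ?case using elim(2,3) by simp
    qed
  qed
  also have "\<dots> = PI (\<lambda>s \<omega>. \<eta> s \<omega> * S s \<omega>)"
    by (rule integral_snd[OF sq_integrable_mult[OF sq_\<eta> sq_S]])
  also have "\<dots> = 0"
    by (rule integral_orthogonal[OF sq_\<eta> sq_S orth])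
  finally show ?thesis .
qed

section \<open>Expansion of the payoff difference\<close>

text \<open>Integrability and value travel together, so that a sum of ten terms needs no separate
  integrability bookkeeping.\<close>

abbreviation HB :: "(real \<Rightarrow> 'a \<Rightarrow> real) \<Rightarrow> real \<Rightarrow> bool" where
  "HB f \<equiv> has_bochner_integral (Lt \<Otimes>\<^sub>M M) (case_prod f)"

lemma HB_I: "integrable (Lt \<Otimes>\<^sub>M M) (case_prod f) \<Longrightarrow> PI f = x \<Longrightarrow> HB f x"
  by (simp add: has_bochner_integral_iff)

lemma HB_add: "HB f x \<Longrightarrow> HB h y \<Longrightarrow> HB (\<lambda>t \<omega>. f t \<omega> + h t \<omega>) (x + y)"
  using has_bochner_integral_add[of "Lt \<Otimes>\<^sub>M M" "case_prod f" x "case_prod h" y] by (simp add: case_prod_beta')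

lemma HB_cmult: "HB f x \<Longrightarrow> HB (\<lambda>t \<omega>. c * f t \<omega>) (c * x)"
  using has_bochner_integral_mult_right[of c "Lt \<Otimes>\<^sub>M M" "case_prod f" x] by (simp add: case_prod_beta')

lemma HB_deterministic:
  assumes "bdd c Lt"
  shows "HB (\<lambda>t \<omega>. c t) (\<integral>t. c t \<partial>Lt)"
proof (rule HB_I)
  have 1: "sq (\<lambda>t \<omega>. 1)" using sq_const_time[of "\<lambda>_. 1"] by simp
  show i: "integrable (Lt \<Otimes>\<^sub>M M) (case_prod (\<lambda>t \<omega>. c t))"
    using sq_integrable_mult[OF sq_deterministic[OF assms] 1] by simp
  show "PI (\<lambda>t \<omega>. c t) = (\<integral>t. c t \<partial>Lt)"
    using integral_fst[OF i] by (simp add: prob_space)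
qed

lemma HB_\<zeta>_square:
  assumes "bdd c Lt"
  shows "HB (\<lambda>t \<omega>. c t * (\<zeta> \<omega>)\<^sup>2) (variance Z * (\<integral>t. c t \<partial>Lt))"
proof (rule HB_I)
  show i: "integrable (Lt \<Otimes>\<^sub>M M) (case_prod (\<lambda>t \<omega>. c t * (\<zeta> \<omega>)\<^sup>2))"
    using sq_integrable_mult[OF sq_mult_bdd[OF assms sq_\<zeta>] sq_\<zeta>] by (simp add: power2_eq_square mult.assoc)
  show "PI (\<lambda>t \<omega>. c t * (\<zeta> \<omega>)\<^sup>2) = variance Z * (\<integral>t. c t \<partial>Lt)"
    using integral_fst[OF i] by (simp add: \<zeta>_def mult.commute)
qed

lemma HB_mult:
  "sq f \<Longrightarrow> sq h \<Longrightarrow> PI (\<lambda>t \<omega>. f t \<omega> * h t \<omega>) = x \<Longrightarrow> HB (\<lambda>t \<omega>. f t \<omega> * h t \<omega>) x"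
  by (intro HB_I sq_integrable_mult)

lemma payoff_difference:
  "2 * (payoff M T a b \<epsilon> \<xi> W \<alpha> \<mu> - payoff M T a b \<epsilon> \<xi> W \<beta> \<mu>) =
    z\<^sub>1\<^sup>2 * c_M T \<epsilon> \<phi> + variance Z * c_V T \<epsilon> \<phi> + PI (\<lambda>t \<omega>. (\<eta> t \<omega>)\<^sup>2 + \<epsilon> * (\<H> t \<omega>)\<^sup>2)"
proof -
  let ?A = "\<lambda>t \<omega>. (Z \<omega> - \<phi> t * Y t \<omega>)\<^sup>2 + \<epsilon> * (Y t \<omega>)\<^sup>2"
  let ?B = "\<lambda>t \<omega>. (\<beta> t \<omega>)\<^sup>2 + \<epsilon> * (D t \<omega>)\<^sup>2"
  let ?E = "\<lambda>t \<omega>. (\<eta> t \<omega>)\<^sup>2 + \<epsilon> * (\<H> t \<omega>)\<^sup>2"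
  note cont = continuous_\<phi> continuous_p continuous_r
  have iA: "HB ?A (PI ?A)"
    using sq_integrable_square[OF sq_\<alpha>_reduced] sq_integrable_square[OF sq_Y] by (intro HB_I) (simp_all add: case_prod_beta')
  have iE: "HB ?E (PI ?E)"
    using sq_integrable_square[OF sq_\<eta>] sq_integrable_square[OF sq_\<H>] by (intro HB_I) (simp_all add: case_prod_beta')
  have t2: "HB (\<lambda>t \<omega>. z\<^sub>1\<^sup>2 * ((p t)\<^sup>2 + \<epsilon> * (r t)\<^sup>2 - 1)) (z\<^sub>1\<^sup>2 * c_M T \<epsilon> \<phi>)"
    unfolding c_M_eq LBINT_0_T by (intro HB_cmult HB_deterministic bdd_continuous continuous_intros cont)
  have t3: "HB (\<lambda>t \<omega>. (\<epsilon> * t\<^sup>2 - 1) * (\<zeta> \<omega>)\<^sup>2) (variance Z * c_V T \<epsilon> \<phi>)"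
    unfolding c_V_eq LBINT_0_T by (intro HB_\<zeta>_square bdd_continuous continuous_intros)
  have b: "bdd p Lt" "bdd (\<lambda>t. \<epsilon> * r t) Lt" "bdd (\<lambda>t. \<epsilon>) Lt" "bdd \<phi> Lt" "bdd (\<lambda>t. t) Lt"
    by (intro bdd_continuous continuous_intros cont)+
  \<comment> \<open>The two halves of \<open>t4\<close>, and likewise of \<open>t5\<close>, need not
    vanish separately, so each pair stays together; the cross terms \<open>t6\<close> to
    \<open>t9\<close> vanish one by one.\<close>
  have t4: "HB (\<lambda>t \<omega>. 2 * z\<^sub>1 * (\<eta> t \<omega> * p t - (\<epsilon> * r t) * \<H> t \<omega>)) (2 * z\<^sub>1 * 0)"
    using sq_integrable_mult[OF sq_\<eta> sq_deterministic[OF b(1)]] sq_integrable_mult[OF sq_deterministic[OF b(2)] sq_\<H>]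
    by (intro HB_cmult HB_I PI_\<eta>_p) (simp add: case_prod_beta')
  have t5: "HB (\<lambda>t \<omega>. 2 * ((\<epsilon> * Y t \<omega>) * \<H> t \<omega> - \<eta> t \<omega> * (\<phi> t * Y t \<omega>))) (2 * 0)"
    using sq_integrable_mult[OF sq_mult_bdd[OF b(3) sq_Y] sq_\<H>] sq_integrable_mult[OF sq_\<eta> sq_mult_bdd[OF b(4) sq_Y]]
    by (intro HB_cmult HB_I PI_\<eta>_Y) (simp add: case_prod_beta')
  have t6: "HB (\<lambda>t \<omega>. (2 * z\<^sub>1 * (\<phi> t - p t * \<phi> t - \<epsilon> * r t)) * Y t \<omega>) 0"
    by (intro HB_mult PI_Y sq_Y sq_deterministic bdd_continuous continuous_intros cont)
  have t7: "HB (\<lambda>t \<omega>. ((2 * \<phi> t - 2 * \<epsilon> * t) * \<zeta> \<omega>) * Y t \<omega>) 0"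
    by (intro HB_mult PI_\<zeta>_Y sq_Y sq_\<zeta> sq_mult_bdd bdd_continuous continuous_intros cont)
  have t8: "HB (\<lambda>t \<omega>. (2 * z\<^sub>1 * (\<epsilon> * r t * t - 1)) * \<zeta> \<omega>) 0"
    by (intro HB_mult PI_\<zeta> sq_\<zeta> sq_deterministic bdd_continuous continuous_intros cont)
  have t9: "HB (\<lambda>t \<omega>. (- 2 * \<epsilon>) * ((t * \<zeta> \<omega>) * \<H> t \<omega>)) ((- 2 * \<epsilon>) * 0)"
    by (intro HB_cmult HB_mult PI_\<zeta>_\<H> sq_mult_bdd[OF b(5)] sq_\<zeta> sq_\<H>)
  note sum = HB_add[OF HB_add[OF HB_add[OF HB_add[OF HB_add[OF HB_add[OF HB_add[OF HB_add[OF
    HB_add[OF iA iE] t2] t3] t4] t5] t6] t7] t8] t9]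
  \<comment> \<open>The squares of \<open>\<phi> Y\<close> and the terms
    \<open>\<epsilon> Y^2\<close> occur on both sides and cancel. Both constants \<open>- 1\<close>
    come from the square of \<open>Z = \<zeta> + z\<^sub>1\<close> in the cost of
    \<open>\<alpha>\<close>.\<close>
  have expand: "?B t \<omega> = ?A t \<omega> + ?E t \<omega> + z\<^sub>1\<^sup>2 * ((p t)\<^sup>2 + \<epsilon> * (r t)\<^sup>2 - 1) + (\<epsilon> * t\<^sup>2 - 1) * (\<zeta> \<omega>)\<^sup>2
      + 2 * z\<^sub>1 * (\<eta> t \<omega> * p t - (\<epsilon> * r t) * \<H> t \<omega>)
      + 2 * ((\<epsilon> * Y t \<omega>) * \<H> t \<omega> - \<eta> t \<omega> * (\<phi> t * Y t \<omega>))
      + (2 * z\<^sub>1 * (\<phi> t - p t * \<phi> t - \<epsilon> * r t)) * Y t \<omega>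
      + ((2 * \<phi> t - 2 * \<epsilon> * t) * \<zeta> \<omega>) * Y t \<omega>
      + (2 * z\<^sub>1 * (\<epsilon> * r t * t - 1)) * \<zeta> \<omega>
      + (- 2 * \<epsilon>) * ((t * \<zeta> \<omega>) * \<H> t \<omega>)" for t \<omega>
  proof -
    have \<beta>: "\<beta> t \<omega> = \<eta> t \<omega> - \<phi> t * Y t \<omega> + z\<^sub>1 * p t" and Z: "Z \<omega> = \<zeta> \<omega> + z\<^sub>1"
      by (simp_all add: \<eta>_def \<zeta>_def)
    show ?thesis unfolding \<beta> Z D_def by (simp add: power2_eq_square algebra_simps)
  qed
  have "HB ?B (PI ?A + PI ?E + z\<^sub>1\<^sup>2 * c_M T \<epsilon> \<phi> + variance Z * c_V T \<epsilon> \<phi>)"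
    using sum unfolding expand[symmetric] by simp
  then have "PI ?B = PI ?A + PI ?E + z\<^sub>1\<^sup>2 * c_M T \<epsilon> \<phi> + variance Z * c_V T \<epsilon> \<phi>"
    by (rule has_bochner_integral_integral_eq)
  moreover have "2 * ((c - 1 / 2 * A) - (c - 1 / 2 * B)) = x + y + E" if "B = A + E + x + y" for A B c E x y :: real
    using that by (simp add: field_simps)
  ultimately show ?thesis unfolding payoff_\<alpha> payoff_\<beta> by blast
qed

lemma PI_nonneg: "0 \<le> PI (\<lambda>t \<omega>. (\<eta> t \<omega>)\<^sup>2 + \<epsilon> * (\<H> t \<omega>)\<^sup>2)"
  using \<epsilon>_pos by (intro Bochner_Integration.integral_nonneg) (auto simp: case_prod_beta')

end

section \<open>Admissibility of the best response and the equivalence\<close>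

context linear_flow
begin

text \<open>A continuous adapted process is progressive. Adaptedness holds because \<open>Y\<close>
  is computed from \<open>\<xi>\<close> and the path of \<open>Wc\<close>, not from the state
  controlled by \<open>\<alpha>\<close>, which involves \<open>Z\<close>.\<close>

lemma best_response_H2: "(\<lambda>t \<omega>. z\<^sub>1 * p t - \<phi> t * Y t \<omega>) \<in> H2 M T GF"
proof (rule H2_I)
  show "sq (\<lambda>t \<omega>. z\<^sub>1 * p t - \<phi> t * Y t \<omega>)"
    by (intro sq_diff sq_deterministic sq_mult_bdd sq_Y bdd_continuous continuous_intros continuous_\<phi> continuous_p)
  show "progressively_measurable T GF (\<lambda>t \<omega>. z\<^sub>1 * p t - \<phi> t * Y t \<omega>)"
    unfolding progressively_measurable_def
  proof
    fix t assume t: "t \<in> {0..T}"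
    show "(\<lambda>(s, \<omega>). z\<^sub>1 * p s - \<phi> s * Y s \<omega>) \<in> borel_measurable (restrict_space borel {0..t} \<Otimes>\<^sub>M GF t)"
    proof (rule borel_measurable_pair_continuous)
      fix s assume s: "s \<in> {0..t}"
      have "subalgebra (Gm t) (Gm s)" using s by (intro subalgebra_Gm_mono) auto
      moreover have "Y s \<in> borel_measurable (Gm s)" using s t by (intro Y_measurable_Gm) auto
      ultimately have "Y s \<in> borel_measurable (Gm t)" by (rule measurable_from_subalg)
      then have [measurable]: "Y s \<in> borel_measurable (GF t)"
        by (rule measurable_from_subalg[OF subalgebra_GF_Gm[OF t]])
      show "(\<lambda>\<omega>. z\<^sub>1 * p s - \<phi> s * Y s \<omega>) \<in> borel_measurable (GF t)" by measurable
    next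
      fix \<omega>
      have "continuous_on {0..T} (\<lambda>s. z\<^sub>1 * p s - \<phi> s * Y s \<omega>)"
        by (intro continuous_intros continuous_\<phi> continuous_p continuous_Y)
      then show "continuous_on {0..t} (\<lambda>s. z\<^sub>1 * p s - \<phi> s * Y s \<omega>)"
        by (rule continuous_on_subset) (use t in auto)
    qed
  qed
qed

lemma CCE_iff:
  "mean_field_CCE M T a b \<epsilon> F \<xi> W \<alpha> \<mu> \<longleftrightarrow> 0 \<le> z\<^sub>1\<^sup>2 * c_M T \<epsilon> \<phi> + variance Z * c_V T \<epsilon> \<phi>"
proof
  assume "mean_field_CCE M T a b \<epsilon> F \<xi> W \<alpha> \<mu>"
  then have opt: "payoff M T a b \<epsilon> \<xi> W \<beta> \<mu> \<le> payoff M T a b \<epsilon> \<xi> W \<alpha> \<mu>" if "\<beta> \<in> H2 M T GF" for \<beta>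
    using that by (auto simp: mean_field_CCE_def)
  interpret deviation M T a b \<epsilon> F \<xi> W \<phi> \<alpha> \<mu> Z "\<lambda>t \<omega>. z\<^sub>1 * p t - \<phi> t * Y t \<omega>"
    by unfold_locales (rule best_response_H2)
  have "\<eta> = (\<lambda>t \<omega>. 0)" by (intro ext) (simp add: \<eta>_def)
  then have "PI (\<lambda>t \<omega>. (\<eta> t \<omega>)\<^sup>2 + \<epsilon> * (\<H> t \<omega>)\<^sup>2) = 0" by (simp add: \<H>_def case_prod_beta')
  then show "0 \<le> z\<^sub>1\<^sup>2 * c_M T \<epsilon> \<phi> + variance Z * c_V T \<epsilon> \<phi>"
    using payoff_difference opt[OF best_response_H2] by simp
next
  assume nonneg: "0 \<le> z\<^sub>1\<^sup>2 * c_M T \<epsilon> \<phi> + variance Z * c_V T \<epsilon> \<phi>"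
  have "payoff M T a b \<epsilon> \<xi> W \<beta> \<mu> \<le> payoff M T a b \<epsilon> \<xi> W \<alpha> \<mu>" if "\<beta> \<in> H2 M T GF" for \<beta>
  proof -
    interpret deviation M T a b \<epsilon> F \<xi> W \<phi> \<alpha> \<mu> Z \<beta>
      by unfold_locales (rule that)
    have "0 \<le> 2 * (payoff M T a b \<epsilon> \<xi> W \<alpha> \<mu> - payoff M T a b \<epsilon> \<xi> W \<beta> \<mu>)"
      unfolding payoff_difference by (intro add_nonneg_nonneg[OF nonneg] PI_nonneg)
    then show ?thesis by simp
  qed
  then show "mean_field_CCE M T a b \<epsilon> F \<xi> W \<alpha> \<mu>"
    using flow conditional_expectation_state by (auto simp: mean_field_CCE_def)
qed

end

theorem proposition5p3:
  fixes M :: "'a measure" and T a b \<epsilon> :: real and F :: "real \<Rightarrow> 'a measure"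
    and \<xi> Z :: "'a \<Rightarrow> real" and W \<alpha> :: "real \<Rightarrow> 'a \<Rightarrow> real"
    and \<mu> :: "'a \<Rightarrow> real \<Rightarrow> real" and \<phi> :: "real \<Rightarrow> real"
  assumes "emission_game M T a b \<epsilon> F \<xi> W"
    and "riccati_solution T \<epsilon> \<phi>"
    and "class_Gl M T F \<xi> W \<phi> \<alpha> \<mu> Z"
  shows "mean_field_CCE M T a b \<epsilon> F \<xi> W \<alpha> \<mu> \<longleftrightarrow>
    (prob_space.expectation M Z)\<^sup>2 * c_M T \<epsilon> \<phi> + prob_space.variance M Z * c_V T \<epsilon> \<phi> \<ge> 0"
proof -
  interpret emission_game M T a b \<epsilon> F \<xi> W by fact
  interpret linear_flow M T a b \<epsilon> F \<xi> W \<phi> \<alpha> \<mu> Z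
    using T_pos assms(2,3) by unfold_locales
  show ?thesis by (rule CCE_iff)
qed

end
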